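(* Let $(\mathcal{C},d,\eta)$ be a symmetric monoidal anti-involutive category which has duals, and let $(\cdot)^*\colon\mathcal{C}\to\mathcal{C}^{\mathrm{op}}$ be a choice of dual functor. Then the canonical monoidal natural isomorphism $d\circ(\cdot)^*\Rightarrow(\cdot)^*\circ d$ (given by uniqueness of duals) makes $(\cdot)^*$ into an anti-involutive functor $(\mathcal{C},d,\eta)\to(\mathcal{C}^{\mathrm{op}},d,\eta^{-1})$.
   Context: A symmetric monoidal anti-involutive category: a symmetric monoidal category $\mathcal{C}$ with a symmetric monoidal functor $d\colon\mathcal{C}\to\mathcal{C}^{\mathrm{op}}$ and a monoidal natural isomorphism $\eta\colon\mathrm{id}\Rightarrow d^2$ with $d(\eta_x)\circ\eta_{dx}=\mathrm{id}_{dx}$. $\mathcal{C}^{\mathrm{op}}$ carries the anti-involution $d$ with $\eta$ inverted. An anti-involutive functor $(F,\phi)\colon(\mathcal{C}_1,d_1,\eta_1)\to(\mathcal{C}_2,d_2,\eta_2)$ is a functor with a natural isomorphism $\phi\colon F\circ d_1\Rightarrow d_2\circ F$ such that $\phi_{d_1x}\circ F((\eta_1)_x)=d_2(\phi_x)\circ(\eta_2)_{F(x)}$. A dual functor is obtained by choosing for each $x$ a dual $(x^*,\mathrm{ev}_x\colon x^*\otimes x\to1,\mathrm{coev}_x\colon1\to x\otimes x^* )$; $f^*$ is the unique morphism with $\mathrm{ev}_x\circ(f^*\otimes\mathrm{id})=\mathrm{ev}_y\circ(\mathrm{id}\otimes f)$ for $f\colon x\to y$, and the monoidal structure uses the braiding.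 Since the symmetric monoidal functor $d$ carries duality data to duality data, $d(x^* )$ and $(dx)^*$ are both duals of $dx$; the canonical isomorphism between them compatible with evaluations and coevaluations is the uniqueness-of-duals isomorphism. *)

theory Defs
  imports Main
begin

record ('o, 'm) mcat =
  mc_obj   :: "'o set"
  mc_arr   :: "'m set"
  mc_dom   :: "'m \<Rightarrow> 'o"
  mc_cod   :: "'m \<Rightarrow> 'o"
  mc_cmp   :: "'m \<Rightarrow> 'm \<Rightarrow> 'm"   (* mc_cmp g f = g \<circ> f *)
  mc_id    :: "'o \<Rightarrow> 'm"
  mc_tens  :: "'o \<Rightarrow> 'o \<Rightarrow> 'o"
  mc_tensm :: "'m \<Rightarrow> 'm \<Rightarrow> 'm"
  mc_unit  :: "'o"
  mc_assoc :: "'o \<Rightarrow> 'o \<Rightarrow> 'o \<Rightarrow> 'm"  (* (a\<otimes>b)\<otimes>c \<rightarrow> a\<otimes>(b\<otimes>c) *)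
  mc_lunit :: "'o \<Rightarrow> 'm"              (* 1\<otimes>a \<rightarrow> a *)
  mc_runit :: "'o \<Rightarrow> 'm"              (* a\<otimes>1 \<rightarrow> a *)
  mc_braid :: "'o \<Rightarrow> 'o \<Rightarrow> 'm"        (* a\<otimes>b \<rightarrow> b\<otimes>a *)

definition mc_hom :: "('o, 'm, 'x) mcat_scheme \<Rightarrow> 'o \<Rightarrow> 'o \<Rightarrow> 'm set" where
  "mc_hom C a b = {f \<in> mc_arr C. mc_dom C f = a \<and> mc_cod C f = b}"

definition is_category :: "('o, 'm, 'x) mcat_scheme \<Rightarrow> bool" where
  "is_category C \<longleftrightarrow>
     (\<forall>f \<in> mc_arr C. mc_dom C f \<in> mc_obj C \<and> mc_cod C f \<in> mc_obj C) \<and>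
     (\<forall>a \<in> mc_obj C. mc_id C a \<in> mc_hom C a a) \<and>
     (\<forall>f \<in> mc_arr C. \<forall>g \<in> mc_arr C. mc_dom C g = mc_cod C f \<longrightarrow>
        mc_cmp C g f \<in> mc_hom C (mc_dom C f) (mc_cod C g)) \<and>
     (\<forall>f \<in> mc_arr C. mc_cmp C f (mc_id C (mc_dom C f)) = f \<and> mc_cmp C (mc_id C (mc_cod C f)) f = f) \<and>
     (\<forall>f \<in> mc_arr C. \<forall>g \<in> mc_arr C. \<forall>h \<in> mc_arr C.
        mc_dom C g = mc_cod C f \<longrightarrow> mc_dom C h = mc_cod C g \<longrightarrow>
        mc_cmp C h (mc_cmp C g f) = mc_cmp C (mc_cmp C h g) f)"

definition mc_iso :: "('o, 'm, 'x) mcat_scheme \<Rightarrow> 'm \<Rightarrow> bool" where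
  "mc_iso C f \<longleftrightarrow> f \<in> mc_arr C \<and>
     (\<exists>g \<in> mc_hom C (mc_cod C f) (mc_dom C f).
        mc_cmp C g f = mc_id C (mc_dom C f) \<and> mc_cmp C f g = mc_id C (mc_cod C f))"

definition mc_inv :: "('o, 'm, 'x) mcat_scheme \<Rightarrow> 'm \<Rightarrow> 'm" where
  "mc_inv C f = (THE g. g \<in> mc_hom C (mc_cod C f) (mc_dom C f) \<and>
        mc_cmp C g f = mc_id C (mc_dom C f) \<and> mc_cmp C f g = mc_id C (mc_cod C f))"

definition monoidal_category :: "('o, 'm, 'x) mcat_scheme \<Rightarrow> bool" where
  "monoidal_category C \<longleftrightarrow> is_category C \<and>
     mc_unit C \<in> mc_obj C \<and>
     (\<forall>a \<in> mc_obj C. \<forall>b \<in> mc_obj C. mc_tens C a b \<in> mc_obj C) \<and>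
     (\<forall>f \<in> mc_arr C. \<forall>g \<in> mc_arr C. mc_tensm C f g \<in>
        mc_hom C (mc_tens C (mc_dom C f) (mc_dom C g)) (mc_tens C (mc_cod C f) (mc_cod C g))) \<and>
     (\<forall>a \<in> mc_obj C. \<forall>b \<in> mc_obj C. mc_tensm C (mc_id C a) (mc_id C b) = mc_id C (mc_tens C a b)) \<and>
     (\<forall>f \<in> mc_arr C. \<forall>g \<in> mc_arr C. \<forall>f' \<in> mc_arr C. \<forall>g' \<in> mc_arr C.
        mc_dom C g = mc_cod C f \<longrightarrow> mc_dom C g' = mc_cod C f' \<longrightarrow>
        mc_tensm C (mc_cmp C g f) (mc_cmp C g' f') = mc_cmp C (mc_tensm C g g') (mc_tensm C f f')) \<and>
     (\<forall>a \<in> mc_obj C. \<forall>b \<in> mc_obj C. \<forall>c \<in> mc_obj C.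
        mc_assoc C a b c \<in> mc_hom C (mc_tens C (mc_tens C a b) c) (mc_tens C a (mc_tens C b c)) \<and>
        mc_iso C (mc_assoc C a b c)) \<and>
     (\<forall>f \<in> mc_arr C. \<forall>g \<in> mc_arr C. \<forall>h \<in> mc_arr C.
        mc_cmp C (mc_assoc C (mc_cod C f) (mc_cod C g) (mc_cod C h)) (mc_tensm C (mc_tensm C f g) h) =
        mc_cmp C (mc_tensm C f (mc_tensm C g h)) (mc_assoc C (mc_dom C f) (mc_dom C g) (mc_dom C h))) \<and>
     (\<forall>a \<in> mc_obj C. mc_lunit C a \<in> mc_hom C (mc_tens C (mc_unit C) a) a \<and> mc_iso C (mc_lunit C a)) \<and>
     (\<forall>f \<in> mc_arr C. mc_cmp C (mc_lunit C (mc_cod C f)) (mc_tensm C (mc_id C (mc_unit C)) f) =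
        mc_cmp C f (mc_lunit C (mc_dom C f))) \<and>
     (\<forall>a \<in> mc_obj C. mc_runit C a \<in> mc_hom C (mc_tens C a (mc_unit C)) a \<and> mc_iso C (mc_runit C a)) \<and>
     (\<forall>f \<in> mc_arr C. mc_cmp C (mc_runit C (mc_cod C f)) (mc_tensm C f (mc_id C (mc_unit C))) =
        mc_cmp C f (mc_runit C (mc_dom C f))) \<and>
     (\<forall>a \<in> mc_obj C. \<forall>b \<in> mc_obj C. \<forall>c \<in> mc_obj C. \<forall>e \<in> mc_obj C.
        mc_cmp C (mc_assoc C a b (mc_tens C c e)) (mc_assoc C (mc_tens C a b) c e) =
        mc_cmp C (mc_tensm C (mc_id C a) (mc_assoc C b c e))
          (mc_cmp C (mc_assoc C a (mc_tens C b c) e) (mc_tensm C (mc_assoc C a b c) (mc_id C e)))) \<and>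
     (\<forall>a \<in> mc_obj C. \<forall>b \<in> mc_obj C.
        mc_cmp C (mc_tensm C (mc_id C a) (mc_lunit C b)) (mc_assoc C a (mc_unit C) b) =
        mc_tensm C (mc_runit C a) (mc_id C b))"

definition symmetric_monoidal_category :: "('o, 'm, 'x) mcat_scheme \<Rightarrow> bool" where
  "symmetric_monoidal_category C \<longleftrightarrow> monoidal_category C \<and>
     (\<forall>a \<in> mc_obj C. \<forall>b \<in> mc_obj C. mc_braid C a b \<in> mc_hom C (mc_tens C a b) (mc_tens C b a)) \<and>
     (\<forall>f \<in> mc_arr C. \<forall>g \<in> mc_arr C.
        mc_cmp C (mc_braid C (mc_cod C f) (mc_cod C g)) (mc_tensm C f g) =
        mc_cmp C (mc_tensm C g f) (mc_braid C (mc_dom C f) (mc_dom C g))) \<and>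
     (\<forall>a \<in> mc_obj C. \<forall>b \<in> mc_obj C.
        mc_cmp C (mc_braid C b a) (mc_braid C a b) = mc_id C (mc_tens C a b)) \<and>
     (\<forall>a \<in> mc_obj C. \<forall>b \<in> mc_obj C. \<forall>c \<in> mc_obj C.
        mc_cmp C (mc_assoc C b c a) (mc_cmp C (mc_braid C a (mc_tens C b c)) (mc_assoc C a b c)) =
        mc_cmp C (mc_tensm C (mc_id C b) (mc_braid C a c))
          (mc_cmp C (mc_assoc C b a c) (mc_tensm C (mc_braid C a b) (mc_id C c))))"

definition mc_op :: "('o, 'm, 'x) mcat_scheme \<Rightarrow> ('o, 'm, 'x) mcat_scheme" where
  "mc_op C = C\<lparr> mc_dom := mc_cod C, mc_cod := mc_dom C,
                mc_cmp := (\<lambda>g f. mc_cmp C f g),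
                mc_assoc := (\<lambda>a b c. mc_inv C (mc_assoc C a b c)),
                mc_lunit := (\<lambda>a. mc_inv C (mc_lunit C a)),
                mc_runit := (\<lambda>a. mc_inv C (mc_runit C a)),
                mc_braid := (\<lambda>a b. mc_braid C b a) \<rparr>"

definition mc_functor ::
  "('o, 'm, 'x) mcat_scheme \<Rightarrow> ('p, 'n, 'y) mcat_scheme \<Rightarrow> ('o \<Rightarrow> 'p) \<Rightarrow> ('m \<Rightarrow> 'n) \<Rightarrow> bool" where
  "mc_functor C D F0 F1 \<longleftrightarrow>
     (\<forall>a \<in> mc_obj C. F0 a \<in> mc_obj D) \<and>
     (\<forall>f \<in> mc_arr C. F1 f \<in> mc_hom D (F0 (mc_dom C f)) (F0 (mc_cod C f))) \<and>
     (\<forall>a \<in> mc_obj C. F1 (mc_id C a) = mc_id D (F0 a)) \<and>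
     (\<forall>f \<in> mc_arr C. \<forall>g \<in> mc_arr C. mc_dom C g = mc_cod C f \<longrightarrow>
        F1 (mc_cmp C g f) = mc_cmp D (F1 g) (F1 f))"

definition sym_monoidal_functor ::
  "('o, 'm, 'x) mcat_scheme \<Rightarrow> ('p, 'n, 'y) mcat_scheme \<Rightarrow> ('o \<Rightarrow> 'p) \<Rightarrow> ('m \<Rightarrow> 'n)
     \<Rightarrow> ('o \<Rightarrow> 'o \<Rightarrow> 'n) \<Rightarrow> 'n \<Rightarrow> bool" where
  "sym_monoidal_functor C D F0 F1 mu eps \<longleftrightarrow> mc_functor C D F0 F1 \<and>
     eps \<in> mc_hom D (mc_unit D) (F0 (mc_unit C)) \<and> mc_iso D eps \<and>
     (\<forall>a \<in> mc_obj C. \<forall>b \<in> mc_obj C.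
        mu a b \<in> mc_hom D (mc_tens D (F0 a) (F0 b)) (F0 (mc_tens C a b)) \<and> mc_iso D (mu a b)) \<and>
     (\<forall>f \<in> mc_arr C. \<forall>g \<in> mc_arr C.
        mc_cmp D (F1 (mc_tensm C f g)) (mu (mc_dom C f) (mc_dom C g)) =
        mc_cmp D (mu (mc_cod C f) (mc_cod C g)) (mc_tensm D (F1 f) (F1 g))) \<and>
     (\<forall>a \<in> mc_obj C. \<forall>b \<in> mc_obj C. \<forall>c \<in> mc_obj C.
        mc_cmp D (F1 (mc_assoc C a b c))
          (mc_cmp D (mu (mc_tens C a b) c) (mc_tensm D (mu a b) (mc_id D (F0 c)))) =
        mc_cmp D (mu a (mc_tens C b c))
          (mc_cmp D (mc_tensm D (mc_id D (F0 a)) (mu b c)) (mc_assoc D (F0 a) (F0 b) (F0 c)))) \<and>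
     (\<forall>a \<in> mc_obj C.
        mc_cmp D (F1 (mc_lunit C a)) (mc_cmp D (mu (mc_unit C) a) (mc_tensm D eps (mc_id D (F0 a))))
        = mc_lunit D (F0 a)) \<and>
     (\<forall>a \<in> mc_obj C.
        mc_cmp D (F1 (mc_runit C a)) (mc_cmp D (mu a (mc_unit C)) (mc_tensm D (mc_id D (F0 a)) eps))
        = mc_runit D (F0 a)) \<and>
     (\<forall>a \<in> mc_obj C. \<forall>b \<in> mc_obj C.
        mc_cmp D (F1 (mc_braid C a b)) (mu a b) = mc_cmp D (mu b a) (mc_braid D (F0 a) (F0 b)))"

text \<open>d = (d0, d1) : C \<rightarrow> C^op symmetric monoidal with structure maps dmu, deps (arrows of C^op);
  eta : id \<Rightarrow> d^2 a monoidal natural isomorphism, where d^2 = d^op \<circ> d carries the composite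
  monoidal structure (mu a b = d1 (dmu a b) \<circ> (dmu (d a) (d b))^-1, eps = d1 deps \<circ> deps^-1),
  and d(eta_x) \<circ> eta_(dx) = id.\<close>

definition anti_involutive_category ::
  "('o, 'm, 'x) mcat_scheme \<Rightarrow> ('o \<Rightarrow> 'o) \<Rightarrow> ('m \<Rightarrow> 'm) \<Rightarrow> ('o \<Rightarrow> 'o \<Rightarrow> 'm) \<Rightarrow> 'm
     \<Rightarrow> ('o \<Rightarrow> 'm) \<Rightarrow> bool" where
  "anti_involutive_category C d0 d1 dmu deps eta \<longleftrightarrow>
     symmetric_monoidal_category C \<and>
     sym_monoidal_functor C (mc_op C) d0 d1 dmu deps \<and>
     (\<forall>a \<in> mc_obj C. eta a \<in> mc_hom C a (d0 (d0 a)) \<and> mc_iso C (eta a)) \<and>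
     (\<forall>f \<in> mc_arr C. mc_cmp C (eta (mc_cod C f)) f = mc_cmp C (d1 (d1 f)) (eta (mc_dom C f))) \<and>
     (\<forall>a \<in> mc_obj C. \<forall>b \<in> mc_obj C.
        eta (mc_tens C a b) =
        mc_cmp C (mc_cmp C (d1 (dmu a b)) (mc_inv C (dmu (d0 a) (d0 b)))) (mc_tensm C (eta a) (eta b))) \<and>
     eta (mc_unit C) = mc_cmp C (d1 deps) (mc_inv C deps) \<and>
     (\<forall>a \<in> mc_obj C. mc_cmp C (d1 (eta a)) (eta (d0 a)) = mc_id C (d0 a))"

definition anti_involutive_functor ::
  "('o, 'm, 'x) mcat_scheme \<Rightarrow> ('o \<Rightarrow> 'o) \<Rightarrow> ('m \<Rightarrow> 'm) \<Rightarrow> ('o \<Rightarrow> 'm)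
   \<Rightarrow> ('p, 'n, 'y) mcat_scheme \<Rightarrow> ('p \<Rightarrow> 'p) \<Rightarrow> ('n \<Rightarrow> 'n) \<Rightarrow> ('p \<Rightarrow> 'n)
   \<Rightarrow> ('o \<Rightarrow> 'p) \<Rightarrow> ('m \<Rightarrow> 'n) \<Rightarrow> ('o \<Rightarrow> 'n) \<Rightarrow> bool" where
  "anti_involutive_functor C1 d01 d11 eta1 C2 d02 d12 eta2 F0 F1 phi \<longleftrightarrow>
     mc_functor C1 C2 F0 F1 \<and>
     (\<forall>a \<in> mc_obj C1. phi a \<in> mc_hom C2 (F0 (d01 a)) (d02 (F0 a)) \<and> mc_iso C2 (phi a)) \<and>
     (\<forall>f \<in> mc_arr C1. mc_cmp C2 (phi (mc_dom C1 f)) (F1 (d11 f)) =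
                       mc_cmp C2 (d12 (F1 f)) (phi (mc_cod C1 f))) \<and>
     (\<forall>a \<in> mc_obj C1. mc_cmp C2 (phi (d01 a)) (F1 (eta1 a)) = mc_cmp C2 (d12 (phi a)) (eta2 (F0 a)))"

definition dual_choice ::
  "('o, 'm, 'x) mcat_scheme \<Rightarrow> ('o \<Rightarrow> 'o) \<Rightarrow> ('o \<Rightarrow> 'm) \<Rightarrow> ('o \<Rightarrow> 'm) \<Rightarrow> bool" where
  "dual_choice C dual ev coev \<longleftrightarrow>
     (\<forall>a \<in> mc_obj C. dual a \<in> mc_obj C \<and>
        ev a \<in> mc_hom C (mc_tens C (dual a) a) (mc_unit C) \<and>
        coev a \<in> mc_hom C (mc_unit C) (mc_tens C a (dual a)) \<and>
        mc_cmp C (mc_runit C a) (mc_cmp C (mc_tensm C (mc_id C a) (ev a))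
          (mc_cmp C (mc_assoc C a (dual a) a)
            (mc_cmp C (mc_tensm C (coev a) (mc_id C a)) (mc_inv C (mc_lunit C a))))) = mc_id C a \<and>
        mc_cmp C (mc_lunit C (dual a)) (mc_cmp C (mc_tensm C (ev a) (mc_id C (dual a)))
          (mc_cmp C (mc_inv C (mc_assoc C (dual a) a (dual a)))
            (mc_cmp C (mc_tensm C (mc_id C (dual a)) (coev a)) (mc_inv C (mc_runit C (dual a))))))
          = mc_id C (dual a))"

definition dual_mor ::
  "('o, 'm, 'x) mcat_scheme \<Rightarrow> ('o \<Rightarrow> 'o) \<Rightarrow> ('o \<Rightarrow> 'm) \<Rightarrow> 'm \<Rightarrow> 'm" where
  "dual_mor C dual ev f = (THE g. g \<in> mc_hom C (dual (mc_cod C f)) (dual (mc_dom C f)) \<and>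
      mc_cmp C (ev (mc_dom C f)) (mc_tensm C g (mc_id C (mc_dom C f))) =
      mc_cmp C (ev (mc_cod C f)) (mc_tensm C (mc_id C (dual (mc_cod C f))) f))"

text \<open>Duality data exhibiting d(a^*) as a dual of d a, obtained by applying the symmetric
  monoidal functor d to the duality data of a (using the braiding to put factors in order).\<close>

definition d_ev ::
  "('o, 'm, 'x) mcat_scheme \<Rightarrow> ('o \<Rightarrow> 'o) \<Rightarrow> ('m \<Rightarrow> 'm) \<Rightarrow> ('o \<Rightarrow> 'o \<Rightarrow> 'm) \<Rightarrow> 'm
     \<Rightarrow> ('o \<Rightarrow> 'o) \<Rightarrow> ('o \<Rightarrow> 'm) \<Rightarrow> 'o \<Rightarrow> 'm" where
  "d_ev C d0 d1 dmu deps dual coev a =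
     mc_cmp C deps (mc_cmp C (d1 (coev a))
       (mc_cmp C (mc_inv C (dmu a (dual a))) (mc_braid C (d0 (dual a)) (d0 a))))"

definition d_coev ::
  "('o, 'm, 'x) mcat_scheme \<Rightarrow> ('o \<Rightarrow> 'o) \<Rightarrow> ('m \<Rightarrow> 'm) \<Rightarrow> ('o \<Rightarrow> 'o \<Rightarrow> 'm) \<Rightarrow> 'm
     \<Rightarrow> ('o \<Rightarrow> 'o) \<Rightarrow> ('o \<Rightarrow> 'm) \<Rightarrow> 'o \<Rightarrow> 'm" where
  "d_coev C d0 d1 dmu deps dual ev a =
     mc_cmp C (mc_braid C (d0 (dual a)) (d0 a))
       (mc_cmp C (dmu (dual a) a) (mc_cmp C (d1 (ev a)) (mc_inv C deps)))"

definition canon_iso ::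
  "('o, 'm, 'x) mcat_scheme \<Rightarrow> ('o \<Rightarrow> 'o) \<Rightarrow> ('m \<Rightarrow> 'm) \<Rightarrow> ('o \<Rightarrow> 'o \<Rightarrow> 'm) \<Rightarrow> 'm
     \<Rightarrow> ('o \<Rightarrow> 'o) \<Rightarrow> ('o \<Rightarrow> 'm) \<Rightarrow> ('o \<Rightarrow> 'm) \<Rightarrow> 'o \<Rightarrow> 'm" where
  "canon_iso C d0 d1 dmu deps dual ev coev a =
     (THE p. p \<in> mc_hom C (d0 (dual a)) (dual (d0 a)) \<and>
        mc_cmp C (ev (d0 a)) (mc_tensm C p (mc_id C (d0 a))) = d_ev C d0 d1 dmu deps dual coev a \<and>
        mc_cmp C (mc_tensm C (mc_id C (d0 a)) p) (d_coev C d0 d1 dmu deps dual ev a) = coev (d0 a))"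

end

theory Submission
  imports Defs
begin

text \<open>
  A dual (xs, ev, coev) of x is characterised by the bijection between arrows e : y \<otimes> x \<rightarrow> 1 and
  arrows y \<rightarrow> xs sending e to its mate along coev, with inverse p \<mapsto> ev \<cdot> (p \<otimes> x); in particular two
  arrows into xs agree as soon as they agree after evaluation. The symmetric monoidal functor d
  carries the zigzag identities of (x*, ev, coev) to those of (d(x*), d_ev, d_coev), up to the
  braiding, and the canonical isomorphism d(x*) \<rightarrow> (d x)* is the mate of d_ev. Both its
  naturality and its compatibility with \<eta> are therefore checked after evaluation: naturality
  reduces to the dinaturality of d_ev, inherited from that of coev, and the \<eta>-condition to the
  monoidality and naturality of \<eta> applied to ev.
\<close>

locale sym_monoidal =
  fixes C :: "('o, 'm, 'x) mcat_scheme"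
  assumes SMC: "symmetric_monoidal_category C"
begin

abbreviation Ob where "Ob \<equiv> mc_obj C"
abbreviation arr where "arr f \<equiv> f \<in> mc_arr C"
abbreviation dm where "dm \<equiv> mc_dom C"
abbreviation cd where "cd \<equiv> mc_cod C"
abbreviation cmp (infixr "\<cdot>" 55) where "g \<cdot> f \<equiv> mc_cmp C g f"
abbreviation tm (infixr "\<otimes>" 60) where "f \<otimes> g \<equiv> mc_tensm C f g"
abbreviation to (infixr "\<odot>" 60) where "a \<odot> b \<equiv> mc_tens C a b"
abbreviation U where "U \<equiv> mc_unit C"
abbreviation idm where "idm \<equiv> mc_id C"
abbreviation as where "as \<equiv> mc_assoc C"
abbreviation lu where "lu \<equiv> mc_lunit C"
abbreviation ru where "ru \<equiv> mc_runit C"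
abbreviation br where "br \<equiv> mc_braid C"
abbreviation iv where "iv \<equiv> mc_inv C"
abbreviation iso where "iso \<equiv> mc_iso C"

lemma monoidal: "monoidal_category C"
  using SMC unfolding symmetric_monoidal_category_def by auto

lemma category: "is_category C"
  using monoidal unfolding monoidal_category_def by auto

lemma dm_ob[simp]: "arr f \<Longrightarrow> dm f \<in> Ob" and cd_ob[simp]: "arr f \<Longrightarrow> cd f \<in> Ob"
  using category unfolding is_category_def by auto

lemma id_typing: "a \<in> Ob \<Longrightarrow> arr (idm a) \<and> dm (idm a) = a \<and> cd (idm a) = a"
  using category unfolding is_category_def mc_hom_def by auto
lemma arr_id[simp]: "a \<in> Ob \<Longrightarrow> arr (idm a)"
  and dm_id[simp]: "a \<in> Ob \<Longrightarrow> dm (idm a) = a"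
  and cd_id[simp]: "a \<in> Ob \<Longrightarrow> cd (idm a) = a"
  using id_typing by auto

lemma comp_typing: "arr f \<Longrightarrow> arr g \<Longrightarrow> dm g = cd f \<Longrightarrow>
    arr (g \<cdot> f) \<and> dm (g \<cdot> f) = dm f \<and> cd (g \<cdot> f) = cd g"
  using category unfolding is_category_def mc_hom_def by auto
lemma arr_comp[simp]: "arr f \<Longrightarrow> arr g \<Longrightarrow> dm g = cd f \<Longrightarrow> arr (g \<cdot> f)"
  and dm_comp[simp]: "arr f \<Longrightarrow> arr g \<Longrightarrow> dm g = cd f \<Longrightarrow> dm (g \<cdot> f) = dm f"
  and cd_comp[simp]: "arr f \<Longrightarrow> arr g \<Longrightarrow> dm g = cd f \<Longrightarrow> cd (g \<cdot> f) = cd g"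
  using comp_typing by auto

lemma comp_id_right[simp]: "arr f \<Longrightarrow> dm f = a \<Longrightarrow> f \<cdot> idm a = f"
  and comp_id_left[simp]: "arr f \<Longrightarrow> cd f = a \<Longrightarrow> idm a \<cdot> f = f"
  using category unfolding is_category_def by auto

lemma comp_assoc[simp]: "arr f \<Longrightarrow> arr g \<Longrightarrow> arr h \<Longrightarrow> dm g = cd f \<Longrightarrow> dm h = cd g \<Longrightarrow>
    (h \<cdot> g) \<cdot> f = h \<cdot> (g \<cdot> f)"
  using category unfolding is_category_def by metis

lemma comp_reassoc: "g \<cdot> f = k \<Longrightarrow> arr f \<Longrightarrow> arr g \<Longrightarrow> arr h \<Longrightarrow> dm g = cd f \<Longrightarrow> dm f = cd h \<Longrightarrow>
    g \<cdot> (f \<cdot> h) = k \<cdot> h"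
  by (metis comp_assoc)

lemma comp_reassoc3: "g \<cdot> (f \<cdot> e) = k \<Longrightarrow> arr e \<Longrightarrow> arr f \<Longrightarrow> arr g \<Longrightarrow> arr h \<Longrightarrow>
    dm g = cd f \<Longrightarrow> dm f = cd e \<Longrightarrow> dm e = cd h \<Longrightarrow> g \<cdot> (f \<cdot> (e \<cdot> h)) = k \<cdot> h"
  by (metis comp_assoc arr_comp cd_comp dm_comp)

lemma unit_ob[simp]: "U \<in> Ob"
  and tens_ob[simp]: "a \<in> Ob \<Longrightarrow> b \<in> Ob \<Longrightarrow> a \<odot> b \<in> Ob"
  using monoidal unfolding monoidal_category_def by auto

lemma tensor_typing: "arr f \<Longrightarrow> arr g \<Longrightarrow>
    arr (f \<otimes> g) \<and> dm (f \<otimes> g) = dm f \<odot> dm g \<and> cd (f \<otimes> g) = cd f \<odot> cd g"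
  using monoidal unfolding monoidal_category_def mc_hom_def by auto
lemma arr_tm[simp]: "arr f \<Longrightarrow> arr g \<Longrightarrow> arr (f \<otimes> g)"
  and dm_tm[simp]: "arr f \<Longrightarrow> arr g \<Longrightarrow> dm (f \<otimes> g) = dm f \<odot> dm g"
  and cd_tm[simp]: "arr f \<Longrightarrow> arr g \<Longrightarrow> cd (f \<otimes> g) = cd f \<odot> cd g"
  using tensor_typing by auto

lemma tensor_id[simp]: "a \<in> Ob \<Longrightarrow> b \<in> Ob \<Longrightarrow> idm a \<otimes> idm b = idm (a \<odot> b)"
  using monoidal unfolding monoidal_category_def by auto

lemma interchange: "arr f \<Longrightarrow> arr g \<Longrightarrow> arr f' \<Longrightarrow> arr g' \<Longrightarrow> dm g = cd f \<Longrightarrow> dm g' = cd f' \<Longrightarrow>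
    (g \<otimes> g') \<cdot> (f \<otimes> f') = (g \<cdot> f) \<otimes> (g' \<cdot> f')"
  using monoidal unfolding monoidal_category_def by metis

lemma assoc_typing: "a \<in> Ob \<Longrightarrow> b \<in> Ob \<Longrightarrow> c \<in> Ob \<Longrightarrow> arr (as a b c) \<and>
    dm (as a b c) = (a \<odot> b) \<odot> c \<and> cd (as a b c) = a \<odot> (b \<odot> c) \<and> iso (as a b c)"
  using monoidal unfolding monoidal_category_def mc_hom_def by auto
lemma arr_as[simp]: "a \<in> Ob \<Longrightarrow> b \<in> Ob \<Longrightarrow> c \<in> Ob \<Longrightarrow> arr (as a b c)"
  and dm_as[simp]: "a \<in> Ob \<Longrightarrow> b \<in> Ob \<Longrightarrow> c \<in> Ob \<Longrightarrow> dm (as a b c) = (a \<odot> b) \<odot> c"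
  and cd_as[simp]: "a \<in> Ob \<Longrightarrow> b \<in> Ob \<Longrightarrow> c \<in> Ob \<Longrightarrow> cd (as a b c) = a \<odot> (b \<odot> c)"
  and iso_as[simp]: "a \<in> Ob \<Longrightarrow> b \<in> Ob \<Longrightarrow> c \<in> Ob \<Longrightarrow> iso (as a b c)"
  using assoc_typing by auto

lemma assoc_nat: "arr f \<Longrightarrow> arr g \<Longrightarrow> arr h \<Longrightarrow>
    as (cd f) (cd g) (cd h) \<cdot> ((f \<otimes> g) \<otimes> h) = (f \<otimes> (g \<otimes> h)) \<cdot> as (dm f) (dm g) (dm h)"
  using monoidal unfolding monoidal_category_def by auto

lemma lunit_typing: "a \<in> Ob \<Longrightarrow> arr (lu a) \<and> dm (lu a) = U \<odot> a \<and> cd (lu a) = a \<and> iso (lu a)"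
  using monoidal unfolding monoidal_category_def mc_hom_def by auto
lemma arr_lu[simp]: "a \<in> Ob \<Longrightarrow> arr (lu a)"
  and dm_lu[simp]: "a \<in> Ob \<Longrightarrow> dm (lu a) = U \<odot> a"
  and cd_lu[simp]: "a \<in> Ob \<Longrightarrow> cd (lu a) = a"
  and iso_lu[simp]: "a \<in> Ob \<Longrightarrow> iso (lu a)"
  using lunit_typing by auto

lemma lunit_nat: "arr f \<Longrightarrow> lu (cd f) \<cdot> (idm U \<otimes> f) = f \<cdot> lu (dm f)"
  using monoidal unfolding monoidal_category_def by auto

lemma runit_typing: "a \<in> Ob \<Longrightarrow> arr (ru a) \<and> dm (ru a) = a \<odot> U \<and> cd (ru a) = a \<and> iso (ru a)"
  using monoidal unfolding monoidal_category_def mc_hom_def by auto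
lemma arr_ru[simp]: "a \<in> Ob \<Longrightarrow> arr (ru a)"
  and dm_ru[simp]: "a \<in> Ob \<Longrightarrow> dm (ru a) = a \<odot> U"
  and cd_ru[simp]: "a \<in> Ob \<Longrightarrow> cd (ru a) = a"
  and iso_ru[simp]: "a \<in> Ob \<Longrightarrow> iso (ru a)"
  using runit_typing by auto

lemma runit_nat: "arr f \<Longrightarrow> ru (cd f) \<cdot> (f \<otimes> idm U) = f \<cdot> ru (dm f)"
  using monoidal unfolding monoidal_category_def by auto

lemma pentagon: "a \<in> Ob \<Longrightarrow> b \<in> Ob \<Longrightarrow> c \<in> Ob \<Longrightarrow> e \<in> Ob \<Longrightarrow>
    as a b (c \<odot> e) \<cdot> as (a \<odot> b) c e = (idm a \<otimes> as b c e) \<cdot> (as a (b \<odot> c) e \<cdot> (as a b c \<otimes> idm e))"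
  using monoidal unfolding monoidal_category_def by auto

lemma triangle: "a \<in> Ob \<Longrightarrow> b \<in> Ob \<Longrightarrow> (idm a \<otimes> lu b) \<cdot> as a U b = ru a \<otimes> idm b"
  using monoidal unfolding monoidal_category_def by auto

lemma braid_typing: "a \<in> Ob \<Longrightarrow> b \<in> Ob \<Longrightarrow>
    arr (br a b) \<and> dm (br a b) = a \<odot> b \<and> cd (br a b) = b \<odot> a"
  using SMC unfolding symmetric_monoidal_category_def mc_hom_def by auto
lemma arr_br[simp]: "a \<in> Ob \<Longrightarrow> b \<in> Ob \<Longrightarrow> arr (br a b)"
  and dm_br[simp]: "a \<in> Ob \<Longrightarrow> b \<in> Ob \<Longrightarrow> dm (br a b) = a \<odot> b"
  and cd_br[simp]: "a \<in> Ob \<Longrightarrow> b \<in> Ob \<Longrightarrow> cd (br a b) = b \<odot> a"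
  using braid_typing by auto

lemma braid_nat: "arr f \<Longrightarrow> arr g \<Longrightarrow> br (cd f) (cd g) \<cdot> (f \<otimes> g) = (g \<otimes> f) \<cdot> br (dm f) (dm g)"
  using SMC unfolding symmetric_monoidal_category_def by auto

lemma braid_braid[simp]: "a \<in> Ob \<Longrightarrow> b \<in> Ob \<Longrightarrow> br b a \<cdot> br a b = idm (a \<odot> b)"
  using SMC unfolding symmetric_monoidal_category_def by auto

lemma hexagon: "a \<in> Ob \<Longrightarrow> b \<in> Ob \<Longrightarrow> c \<in> Ob \<Longrightarrow>
    as b c a \<cdot> (br a (b \<odot> c) \<cdot> as a b c) = (idm b \<otimes> br a c) \<cdot> (as b a c \<cdot> (br a b \<otimes> idm c))"
  using SMC unfolding symmetric_monoidal_category_def by auto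

lemma inv_typing:
  assumes "iso f"
  shows "arr (iv f) \<and> dm (iv f) = cd f \<and> cd (iv f) = dm f
     \<and> iv f \<cdot> f = idm (dm f) \<and> f \<cdot> iv f = idm (cd f)"
proof -
  from assms obtain g where g: "g \<in> mc_hom C (cd f) (dm f)"
    "g \<cdot> f = idm (dm f)" "f \<cdot> g = idm (cd f)"
    and af: "arr f" unfolding mc_iso_def by auto
  have ag: "arr g" "dm g = cd f" "cd g = dm f" using g(1) unfolding mc_hom_def by auto
  have "iv f = g" unfolding mc_inv_def
  proof (rule the_equality)
    show "g \<in> mc_hom C (cd f) (dm f) \<and> g \<cdot> f = idm (dm f) \<and> f \<cdot> g = idm (cd f)" using g by auto
  next
    fix h assume h: "h \<in> mc_hom C (cd f) (dm f) \<and> h \<cdot> f = idm (dm f) \<and> f \<cdot> h = idm (cd f)"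
    then have ah: "arr h" "dm h = cd f" "cd h = dm f" unfolding mc_hom_def by auto
    have "h = (g \<cdot> f) \<cdot> h" using h ah g by simp
    also have "\<dots> = g \<cdot> (f \<cdot> h)" using ah ag af by simp
    also have "\<dots> = g" using h ag by simp
    finally show "h = g" .
  qed
  then show ?thesis using g ag by simp
qed

lemma iso_is_arr: "iso f \<Longrightarrow> arr f"
  unfolding mc_iso_def by auto

lemma arr_iv[simp]: "iso f \<Longrightarrow> arr (iv f)"
  and dm_iv[simp]: "iso f \<Longrightarrow> dm (iv f) = cd f"
  and cd_iv[simp]: "iso f \<Longrightarrow> cd (iv f) = dm f"
  and inv_comp[simp]: "iso f \<Longrightarrow> dm f = a \<Longrightarrow> iv f \<cdot> f = idm a"
  and comp_inv[simp]: "iso f \<Longrightarrow> cd f = a \<Longrightarrow> f \<cdot> iv f = idm a"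
  using inv_typing by auto

lemma inv_comp_cancel[simp]: "iso f \<Longrightarrow> arr h \<Longrightarrow> dm f = cd h \<Longrightarrow> iv f \<cdot> (f \<cdot> h) = h"
  by (simp add: comp_reassoc[OF inv_comp] iso_is_arr)

lemma comp_inv_cancel[simp]: "iso f \<Longrightarrow> arr h \<Longrightarrow> cd f = cd h \<Longrightarrow> f \<cdot> (iv f \<cdot> h) = h"
  by (simp add: comp_reassoc[OF comp_inv] iso_is_arr)

lemma isoI: "arr f \<Longrightarrow> arr g \<Longrightarrow> dm g = cd f \<Longrightarrow> cd g = dm f \<Longrightarrow>
    g \<cdot> f = idm (dm f) \<Longrightarrow> f \<cdot> g = idm (cd f) \<Longrightarrow> iso f"
  unfolding mc_iso_def mc_hom_def by auto

lemma inv_eqI: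
  assumes "arr f" "arr g" "dm g = cd f" "cd g = dm f" "g \<cdot> f = idm (dm f)" "f \<cdot> g = idm (cd f)"
  shows "iv f = g"
proof -
  have i: "iso f" using assms by (rule isoI)
  have "iv f = iv f \<cdot> (f \<cdot> g)" using assms i by simp
  also have "\<dots> = g" using assms(1-4) i by (simp del: comp_inv)
  finally show ?thesis .
qed

lemma iso_comp[simp]: "iso f \<Longrightarrow> iso g \<Longrightarrow> dm g = cd f \<Longrightarrow> iso (g \<cdot> f)"
  by (rule isoI[where g="iv f \<cdot> iv g"]) (auto simp: iso_is_arr)
lemma inv_of_comp: "iso f \<Longrightarrow> iso g \<Longrightarrow> dm g = cd f \<Longrightarrow> iv (g \<cdot> f) = iv f \<cdot> iv g"
  by (rule inv_eqI) (auto simp: iso_is_arr)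
lemma iso_tensor[simp]: "iso f \<Longrightarrow> iso g \<Longrightarrow> iso (f \<otimes> g)"
  by (rule isoI[where g="iv f \<otimes> iv g"]) (auto simp: iso_is_arr interchange)
lemma inv_tensor: "iso f \<Longrightarrow> iso g \<Longrightarrow> iv (f \<otimes> g) = iv f \<otimes> iv g"
  by (rule inv_eqI) (auto simp: iso_is_arr interchange)
lemma iso_id[simp]: "a \<in> Ob \<Longrightarrow> iso (idm a)"
  by (rule isoI[where g="idm a"]) auto
lemma inv_id[simp]: "a \<in> Ob \<Longrightarrow> iv (idm a) = idm a"
  by (rule inv_eqI) auto
lemma iso_inv[simp]: "iso f \<Longrightarrow> iso (iv f)"
  by (rule isoI[where g=f]) (auto simp: iso_is_arr)
lemma inv_inv[simp]: "iso f \<Longrightarrow> iv (iv f) = f"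
  by (rule inv_eqI) (auto simp: iso_is_arr)
lemma iso_braid[simp]: "a \<in> Ob \<Longrightarrow> b \<in> Ob \<Longrightarrow> iso (br a b)"
  by (rule isoI[where g="br b a"]) auto
lemma inv_braid[simp]: "a \<in> Ob \<Longrightarrow> b \<in> Ob \<Longrightarrow> iv (br a b) = br b a"
  by (rule inv_eqI) auto

lemma iso_cancel_right:
  assumes "iso x" "arr h1" "arr h2" "dm h1 = cd x" "dm h2 = cd x" "h1 \<cdot> x = h2 \<cdot> x"
  shows "h1 = h2"
proof -
  have "h1 = (h1 \<cdot> x) \<cdot> iv x" using assms(1-5) iso_is_arr[OF assms(1)] by simp
  also have "\<dots> = (h2 \<cdot> x) \<cdot> iv x" using assms(6) by (simp only:)
  also have "\<dots> = h2" using assms(1-5) iso_is_arr[OF assms(1)] by simp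
  finally show ?thesis .
qed

lemma iso_cancel_left:
  assumes "iso x" "arr h1" "arr h2" "cd h1 = dm x" "cd h2 = dm x" "x \<cdot> h1 = x \<cdot> h2"
  shows "h1 = h2"
proof -
  have "h1 = iv x \<cdot> (x \<cdot> h1)" using assms(1-5) iso_is_arr[OF assms(1)] by simp
  also have "\<dots> = iv x \<cdot> (x \<cdot> h2)" using assms(6) by (simp only:)
  also have "\<dots> = h2" using assms(1-5) iso_is_arr[OF assms(1)] by simp
  finally show ?thesis .
qed

lemma iso_flip:
  assumes "iso a" "iso b" "arr f" "arr g" "dm a = cd f" "dm g = cd b" "dm f = dm b" "cd a = cd g"
    and "a \<cdot> f = g \<cdot> b"
  shows "iv a \<cdot> g = f \<cdot> iv b"
proof -
  have ab: "arr a" "arr b" using assms iso_is_arr by auto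
  have "iv a \<cdot> g = iv a \<cdot> ((g \<cdot> b) \<cdot> iv b)" using assms ab by simp
  also have "\<dots> = iv a \<cdot> ((a \<cdot> f) \<cdot> iv b)" using assms(9) by simp
  also have "\<dots> = f \<cdot> iv b" using assms(1-8) ab by simp
  finally show ?thesis .
qed

lemma iso_solve_right: "iso b \<Longrightarrow> arr g \<Longrightarrow> dm g = cd b \<Longrightarrow> g \<cdot> b = k \<Longrightarrow> g = k \<cdot> iv b"
  by (metis comp_assoc comp_id_right comp_inv arr_iv cd_iv iso_is_arr)

lemma iso_solve_left: "iso b \<Longrightarrow> arr g \<Longrightarrow> cd g = dm b \<Longrightarrow> b \<cdot> g = k \<Longrightarrow> g = iv b \<cdot> k"
  by (metis inv_comp_cancel)

lemma tensor_unit_left_cancel: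
  assumes "arr f" "arr g" "dm f = dm g" "cd f = cd g" "idm U \<otimes> f = idm U \<otimes> g"
  shows "f = g"
proof -
  have "f \<cdot> lu (dm f) = g \<cdot> lu (dm f)"
    using lunit_nat[OF assms(1)] lunit_nat[OF assms(2)] assms by simp
  then show ?thesis by (rule iso_cancel_right[rotated 5]) (use assms in auto)
qed

lemma tensor_unit_right_cancel:
  assumes "arr f" "arr g" "dm f = dm g" "cd f = cd g" "f \<otimes> idm U = g \<otimes> idm U"
  shows "f = g"
proof -
  have "f \<cdot> ru (dm f) = g \<cdot> ru (dm f)"
    using runit_nat[OF assms(1)] runit_nat[OF assms(2)] assms by simp
  then show ?thesis by (rule iso_cancel_right[rotated 5]) (use assms in auto)
qed

lemma tensor_inv_id[simp]:
  "iso f \<Longrightarrow> a \<in> Ob \<Longrightarrow> (iv f \<otimes> idm a) \<cdot> (f \<otimes> idm a) = idm (dm f \<odot> a)"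
  "iso f \<Longrightarrow> a \<in> Ob \<Longrightarrow> (f \<otimes> idm a) \<cdot> (iv f \<otimes> idm a) = idm (cd f \<odot> a)"
  "iso f \<Longrightarrow> a \<in> Ob \<Longrightarrow> (idm a \<otimes> iv f) \<cdot> (idm a \<otimes> f) = idm (a \<odot> dm f)"
  "iso f \<Longrightarrow> a \<in> Ob \<Longrightarrow> (idm a \<otimes> f) \<cdot> (idm a \<otimes> iv f) = idm (a \<odot> cd f)"
  by (simp_all add: interchange iso_is_arr)

lemma tensor_inv_id_cancel[simp]:
  "iso f \<Longrightarrow> a \<in> Ob \<Longrightarrow> arr h \<Longrightarrow> cd h = dm f \<odot> a \<Longrightarrow> (iv f \<otimes> idm a) \<cdot> ((f \<otimes> idm a) \<cdot> h) = h"
  "iso f \<Longrightarrow> a \<in> Ob \<Longrightarrow> arr h \<Longrightarrow> cd h = cd f \<odot> a \<Longrightarrow> (f \<otimes> idm a) \<cdot> ((iv f \<otimes> idm a) \<cdot> h) = h"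
  "iso f \<Longrightarrow> a \<in> Ob \<Longrightarrow> arr h \<Longrightarrow> cd h = a \<odot> dm f \<Longrightarrow> (idm a \<otimes> iv f) \<cdot> ((idm a \<otimes> f) \<cdot> h) = h"
  "iso f \<Longrightarrow> a \<in> Ob \<Longrightarrow> arr h \<Longrightarrow> cd h = a \<odot> cd f \<Longrightarrow> (idm a \<otimes> f) \<cdot> ((idm a \<otimes> iv f) \<cdot> h) = h"
  by (simp_all add: comp_reassoc[OF interchange] iso_is_arr)

(* Kelly's argument: the pentagon at (1, 1, a, b) and the triangle axiom, then cancel 1 \<otimes> -. *)
lemma lunit_tensor:
  assumes "a \<in> Ob" "b \<in> Ob"
  shows "lu (a \<odot> b) \<cdot> as U a b = lu a \<otimes> idm b"
proof -
  note [simp] = assms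
  define X where "X = as U (U \<odot> a) b \<cdot> (as U U a \<otimes> idm b)"
  have X: "arr X" "dm X = ((U \<odot> U) \<odot> a) \<odot> b" "cd X = U \<odot> ((U \<odot> a) \<odot> b)" "iso X"
    unfolding X_def by auto
  have P: "as U U (a \<odot> b) \<cdot> as (U \<odot> U) a b = (idm U \<otimes> as U a b) \<cdot> X"
    using pentagon[of U U a b] unfolding X_def by simp
  have T1: "(idm U \<otimes> lu (a \<odot> b)) \<cdot> as U U (a \<odot> b) = ru U \<otimes> idm (a \<odot> b)"
    using triangle[of U "a \<odot> b"] by simp
  have T2: "(idm U \<otimes> lu a) \<cdot> as U U a = ru U \<otimes> idm a"
    using triangle[of U a] by simp
  have N1: "as U a b \<cdot> ((ru U \<otimes> idm a) \<otimes> idm b) = (ru U \<otimes> idm (a \<odot> b)) \<cdot> as (U \<odot> U) a b"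
    using assoc_nat[of "ru U" "idm a" "idm b"] by simp
  have N2: "as U a b \<cdot> ((idm U \<otimes> lu a) \<otimes> idm b) = (idm U \<otimes> (lu a \<otimes> idm b)) \<cdot> as U (U \<odot> a) b"
    using assoc_nat[of "idm U" "lu a" "idm b"] by simp
  have I: "(idm U \<otimes> lu (a \<odot> b)) \<cdot> (idm U \<otimes> as U a b) = idm U \<otimes> (lu (a \<odot> b) \<cdot> as U a b)"
    by (simp add: interchange)
  have "(idm U \<otimes> (lu (a \<odot> b) \<cdot> as U a b)) \<cdot> X = (idm U \<otimes> lu (a \<odot> b)) \<cdot> ((idm U \<otimes> as U a b) \<cdot> X)"
    using X by (simp add: comp_reassoc[OF I])
  also have "\<dots> = (idm U \<otimes> lu (a \<odot> b)) \<cdot> (as U U (a \<odot> b) \<cdot> as (U \<odot> U) a b)"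
    using P by simp
  also have "\<dots> = (ru U \<otimes> idm (a \<odot> b)) \<cdot> as (U \<odot> U) a b"
    by (simp add: comp_reassoc[OF T1])
  also have "\<dots> = as U a b \<cdot> ((ru U \<otimes> idm a) \<otimes> idm b)"
    by (simp add: N1)
  also have "\<dots> = as U a b \<cdot> (((idm U \<otimes> lu a) \<otimes> idm b) \<cdot> (as U U a \<otimes> idm b))"
    by (simp add: T2[symmetric] interchange)
  also have "\<dots> = (idm U \<otimes> (lu a \<otimes> idm b)) \<cdot> X"
    unfolding X_def by (simp add: comp_reassoc[OF N2])
  finally have "idm U \<otimes> (lu (a \<odot> b) \<cdot> as U a b) = idm U \<otimes> (lu a \<otimes> idm b)"
    by (rule iso_cancel_right[rotated 5]) (use X in auto)
  then show ?thesis by (rule tensor_unit_left_cancel[rotated 4]) auto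
qed

lemma runit_tensor:
  assumes "a \<in> Ob" "b \<in> Ob"
  shows "(idm a \<otimes> ru b) \<cdot> as a b U = ru (a \<odot> b)"
proof -
  note [simp] = assms
  define X where "X = as a (b \<odot> U) U \<cdot> (as a b U \<otimes> idm U)"
  have X: "arr X" "dm X = ((a \<odot> b) \<odot> U) \<odot> U" "cd X = a \<odot> ((b \<odot> U) \<odot> U)" "iso X"
    unfolding X_def by auto
  have P: "as a b (U \<odot> U) \<cdot> as (a \<odot> b) U U = (idm a \<otimes> as b U U) \<cdot> X"
    using pentagon[of a b U U] unfolding X_def by simp
  have T1: "(idm (a \<odot> b) \<otimes> lu U) \<cdot> as (a \<odot> b) U U = ru (a \<odot> b) \<otimes> idm U"
    using triangle[of "a \<odot> b" U] by simp
  have T2: "(idm b \<otimes> lu U) \<cdot> as b U U = ru b \<otimes> idm U"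
    using triangle[of b U] by simp
  have N1: "as a b U \<cdot> (idm (a \<odot> b) \<otimes> lu U) = (idm a \<otimes> (idm b \<otimes> lu U)) \<cdot> as a b (U \<odot> U)"
    using assoc_nat[of "idm a" "idm b" "lu U"] by simp
  have N2: "as a b U \<cdot> ((idm a \<otimes> ru b) \<otimes> idm U) = (idm a \<otimes> (ru b \<otimes> idm U)) \<cdot> as a (b \<odot> U) U"
    using assoc_nat[of "idm a" "ru b" "idm U"] by simp
  have I: "(idm a \<otimes> (idm b \<otimes> lu U)) \<cdot> (idm a \<otimes> as b U U) = idm a \<otimes> (ru b \<otimes> idm U)"
    by (simp add: interchange T2)
  have "as a b U \<cdot> (ru (a \<odot> b) \<otimes> idm U) = as a b U \<cdot> ((idm (a \<odot> b) \<otimes> lu U) \<cdot> as (a \<odot> b) U U)"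
    by (simp add: T1)
  also have "\<dots> = (idm a \<otimes> (idm b \<otimes> lu U)) \<cdot> (as a b (U \<odot> U) \<cdot> as (a \<odot> b) U U)"
    by (simp add: comp_reassoc[OF N1])
  also have "\<dots> = (idm a \<otimes> (ru b \<otimes> idm U)) \<cdot> X"
    using X by (simp add: P comp_reassoc[OF I])
  also have "\<dots> = as a b U \<cdot> (((idm a \<otimes> ru b) \<otimes> idm U) \<cdot> (as a b U \<otimes> idm U))"
    unfolding X_def by (simp add: comp_reassoc[OF N2])
  also have "\<dots> = as a b U \<cdot> (((idm a \<otimes> ru b) \<cdot> as a b U) \<otimes> idm U)"
    by (simp add: interchange)
  finally have "ru (a \<odot> b) \<otimes> idm U = ((idm a \<otimes> ru b) \<cdot> as a b U) \<otimes> idm U"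
    by (rule iso_cancel_left[rotated 5]) auto
  then show ?thesis by (rule tensor_unit_right_cancel[rotated 4, symmetric]) auto
qed

lemma lunit_unit_eq_runit_unit: "lu U = ru U"
proof -
  have "lu U \<cdot> (idm U \<otimes> lu U) = lu U \<cdot> lu (U \<odot> U)"
    using lunit_nat[of "lu U"] by simp
  then have "idm U \<otimes> lu U = lu (U \<odot> U)"
    by (rule iso_cancel_left[rotated 5]) auto
  then have "ru U \<otimes> idm U = lu U \<otimes> idm U"
    using triangle[of U U] lunit_tensor[of U U] by simp
  then show ?thesis by (rule tensor_unit_right_cancel[rotated 4, symmetric]) auto
qed

lemma lunit_braid:
  assumes "a \<in> Ob"
  shows "lu a \<cdot> br a U = ru a"
proof -
  note [simp] = assms
  have H: "as U U a \<cdot> (br a (U \<odot> U) \<cdot> as a U U) = (idm U \<otimes> br a U) \<cdot> (as U a U \<cdot> (br a U \<otimes> idm U))"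
    using hexagon[of a U U] by simp
  have L1: "lu (U \<odot> a) \<cdot> as U U a = lu U \<otimes> idm a"
    using lunit_tensor[of U a] by simp
  have L2: "lu (a \<odot> U) \<cdot> as U a U = lu a \<otimes> idm U"
    using lunit_tensor[of a U] by simp
  have Nb: "br a U \<cdot> (idm a \<otimes> lu U) = (lu U \<otimes> idm a) \<cdot> br a (U \<odot> U)"
    using braid_nat[of "idm a" "lu U"] by simp
  have Nl: "lu (U \<odot> a) \<cdot> (idm U \<otimes> br a U) = br a U \<cdot> lu (a \<odot> U)"
    using lunit_nat[of "br a U"] by simp
  have "br a U \<cdot> (ru a \<otimes> idm U) = br a U \<cdot> ((idm a \<otimes> lu U) \<cdot> as a U U)"
    by (simp add: triangle)
  also have "\<dots> = lu (U \<odot> a) \<cdot> (as U U a \<cdot> (br a (U \<odot> U) \<cdot> as a U U))"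
    by (simp add: comp_reassoc[OF Nb] comp_reassoc[OF L1, symmetric])
  also have "\<dots> = br a U \<cdot> ((lu a \<otimes> idm U) \<cdot> (br a U \<otimes> idm U))"
    by (simp add: H comp_reassoc[OF Nl] comp_reassoc[OF L2])
  also have "\<dots> = br a U \<cdot> ((lu a \<cdot> br a U) \<otimes> idm U)"
    by (simp add: interchange)
  finally have "ru a \<otimes> idm U = (lu a \<cdot> br a U) \<otimes> idm U"
    by (rule iso_cancel_left[rotated 5]) auto
  then show ?thesis by (rule tensor_unit_right_cancel[rotated 4, symmetric]) auto
qed

lemma inv_lunit_eq:
  assumes "a \<in> Ob"
  shows "iv (lu a) = br a U \<cdot> iv (ru a)"
proof -
  have "iv (lu a) = iv (lu a) \<cdot> ((lu a \<cdot> br a U) \<cdot> iv (ru a))"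
    using assms by (simp add: lunit_braid)
  also have "\<dots> = br a U \<cdot> iv (ru a)"
    using assms by simp
  finally show ?thesis .
qed

lemma runit_braid: "a \<in> Ob \<Longrightarrow> ru a \<cdot> br U a = lu a"
  using comp_reassoc[OF lunit_braid, of a "br U a"] by simp

lemma braid_braid_cancel[simp]:
  "a \<in> Ob \<Longrightarrow> b \<in> Ob \<Longrightarrow> arr h \<Longrightarrow> cd h = a \<odot> b \<Longrightarrow> br b a \<cdot> (br a b \<cdot> h) = h"
  by (simp add: comp_reassoc[OF braid_braid])

lemma braid_braid_tensor[simp]:
  "a \<in> Ob \<Longrightarrow> b \<in> Ob \<Longrightarrow> c \<in> Ob \<Longrightarrow> (br b a \<otimes> idm c) \<cdot> (br a b \<otimes> idm c) = idm ((a \<odot> b) \<odot> c)"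
  "a \<in> Ob \<Longrightarrow> b \<in> Ob \<Longrightarrow> c \<in> Ob \<Longrightarrow> (idm c \<otimes> br b a) \<cdot> (idm c \<otimes> br a b) = idm (c \<odot> (a \<odot> b))"
  by (simp_all add: interchange)

lemma braid_braid_tensor_cancel[simp]:
  "a \<in> Ob \<Longrightarrow> b \<in> Ob \<Longrightarrow> c \<in> Ob \<Longrightarrow> arr h \<Longrightarrow> cd h = (a \<odot> b) \<odot> c \<Longrightarrow>
    (br b a \<otimes> idm c) \<cdot> ((br a b \<otimes> idm c) \<cdot> h) = h"
  "a \<in> Ob \<Longrightarrow> b \<in> Ob \<Longrightarrow> c \<in> Ob \<Longrightarrow> arr h \<Longrightarrow> cd h = c \<odot> (a \<odot> b) \<Longrightarrow>
    (idm c \<otimes> br b a) \<cdot> ((idm c \<otimes> br a b) \<cdot> h) = h"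
  by (simp_all add: comp_reassoc[OF interchange])

lemma braid_tensor_right:
  assumes "a \<in> Ob" "b \<in> Ob" "c \<in> Ob"
  shows "br a (b \<odot> c) \<cdot> as a b c =
    iv (as b c a) \<cdot> ((idm b \<otimes> br a c) \<cdot> (as b a c \<cdot> (br a b \<otimes> idm c)))"
  by (rule iso_solve_left) (use assms hexagon in auto)

lemma braid_tensor_left:
  assumes "a \<in> Ob" "b \<in> Ob" "c \<in> Ob"
  shows "as c a b \<cdot> ((br a c \<otimes> idm b) \<cdot> (iv (as a c b) \<cdot> ((idm a \<otimes> br b c) \<cdot> as a b c)))
    = br (a \<odot> b) c"
proof -
  note [simp] = assms
  have Hc: "br c (a \<odot> b) \<cdot> as c a b =
      iv (as a b c) \<cdot> ((idm a \<otimes> br c b) \<cdot> (as a c b \<cdot> (br c a \<otimes> idm b)))"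
    using braid_tensor_right[of c a b] by simp
  have "br c (a \<odot> b) \<cdot> (as c a b \<cdot> ((br a c \<otimes> idm b) \<cdot> (iv (as a c b) \<cdot> ((idm a \<otimes> br b c) \<cdot> as a b c))))
     = br c (a \<odot> b) \<cdot> br (a \<odot> b) c"
    by (simp add: comp_reassoc[OF Hc])
  then show ?thesis by (rule iso_cancel_left[rotated 5]) auto
qed

lemma braid_tensor_left_hexagons:
  assumes "a \<in> Ob" "b \<in> Ob" "c \<in> Ob"
  shows "as c a b \<cdot> (br b (c \<odot> a) \<cdot> (as b c a \<cdot> (br a (b \<odot> c) \<cdot> as a b c))) = br (a \<odot> b) c"
proof -
  note [simp] = assms
  have Ha: "as b c a \<cdot> (br a (b \<odot> c) \<cdot> as a b c) = (idm b \<otimes> br a c) \<cdot> (as b a c \<cdot> (br a b \<otimes> idm c))"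
    using hexagon[of a b c] by simp
  have Nb: "br b (c \<odot> a) \<cdot> (idm b \<otimes> br a c) = (br a c \<otimes> idm b) \<cdot> br b (a \<odot> c)"
    using braid_nat[of "idm b" "br a c"] by simp
  have Hb: "br b (a \<odot> c) \<cdot> as b a c =
      iv (as a c b) \<cdot> ((idm a \<otimes> br b c) \<cdot> (as a b c \<cdot> (br b a \<otimes> idm c)))"
    using braid_tensor_right[of b a c] by simp
  have "as c a b \<cdot> (br b (c \<odot> a) \<cdot> (as b c a \<cdot> (br a (b \<odot> c) \<cdot> as a b c)))
    = as c a b \<cdot> ((br a c \<otimes> idm b) \<cdot> (iv (as a c b) \<cdot> ((idm a \<otimes> br b c) \<cdot> as a b c)))"
    by (simp add: Ha comp_reassoc[OF Nb] comp_reassoc[OF Hb])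
  also have "\<dots> = br (a \<odot> b) c" using braid_tensor_left by simp
  finally show ?thesis .
qed

lemma tensor_inv_runit:
  assumes "z \<in> Ob" "y \<in> Ob"
  shows "idm z \<otimes> iv (ru y) = as z y U \<cdot> iv (ru (z \<odot> y))"
proof -
  have "iv (idm z \<otimes> ru y) \<cdot> idm (z \<odot> y) = as z y U \<cdot> iv (ru (z \<odot> y))"
    by (rule iso_flip) (use assms runit_tensor[of z y] in auto)
  then show ?thesis using assms by (simp add: inv_tensor)
qed

lemma pentagon_inv_left:
  assumes "a \<in> Ob" "b \<in> Ob" "c \<in> Ob" "e \<in> Ob"
  shows "as a b (c \<odot> e) \<cdot> (as (a \<odot> b) c e \<cdot> (iv (as a b c) \<otimes> idm e)) =
    (idm a \<otimes> as b c e) \<cdot> as a (b \<odot> c) e"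
  using assms by (simp add: comp_reassoc[OF pentagon])

lemma pentagon_inv_right:
  assumes "a \<in> Ob" "b \<in> Ob" "c \<in> Ob" "e \<in> Ob"
  shows "(idm a \<otimes> iv (as b c e)) \<cdot> as a b (c \<odot> e) =
    as a (b \<odot> c) e \<cdot> ((as a b c \<otimes> idm e) \<cdot> iv (as (a \<odot> b) c e))"
proof -
  have "as a b (c \<odot> e) =
      ((idm a \<otimes> as b c e) \<cdot> (as a (b \<odot> c) e \<cdot> (as a b c \<otimes> idm e))) \<cdot> iv (as (a \<odot> b) c e)"
    by (rule iso_solve_right) (use assms pentagon[of a b c e] in auto)
  then show ?thesis using assms by simp
qed

(* For (e, c) = (ev, coev) these are the two zigzag composites of dual_choice; in general
   mate x xs coev y e : y \<rightarrow> xs is the transpose of e : y \<otimes> x \<rightarrow> 1 along coev. *)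
definition snake where
  "snake z y x e c = ru z \<cdot> ((idm z \<otimes> e) \<cdot> (as z y x \<cdot> ((c \<otimes> idm x) \<cdot> iv (lu x))))"

definition mate where
  "mate x xs coev y e = lu xs \<cdot> ((e \<otimes> idm xs) \<cdot> (iv (as y x xs) \<cdot> ((idm y \<otimes> coev) \<cdot> iv (ru y))))"

definition duality_data where
  "duality_data x xs ev coev \<longleftrightarrow> x \<in> Ob \<and> xs \<in> Ob \<and> arr ev \<and> dm ev = xs \<odot> x \<and> cd ev = U \<and>
     arr coev \<and> dm coev = U \<and> cd coev = x \<odot> xs"

lemma snake_braid_eq_mate:
  assumes "u \<in> Ob" "v \<in> Ob" "arr e" "dm e = u \<odot> v" "cd e = U" "arr c" "dm c = U" "cd c = v \<odot> u"
  shows "snake u v u (e \<cdot> br v u) (br v u \<cdot> c) = mate v u c u e"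
proof -
  note [simp] = assms
  have I1: "idm u \<otimes> (e \<cdot> br v u) = (idm u \<otimes> e) \<cdot> (idm u \<otimes> br v u)"
    by (simp add: interchange)
  have I2: "(br v u \<cdot> c) \<otimes> idm u = (br v u \<otimes> idm u) \<cdot> (c \<otimes> idm u)"
    by (simp add: interchange)
  have H: "(idm u \<otimes> br v u) \<cdot> (as u v u \<cdot> (br v u \<otimes> idm u)) = as u u v \<cdot> (br v (u \<odot> u) \<cdot> as v u u)"
    using hexagon[of v u u] by simp
  have Nc: "(c \<otimes> idm u) \<cdot> br u U = br u (v \<odot> u) \<cdot> (idm u \<otimes> c)"
    using braid_nat[of "idm u" c] by simp
  have Nd: "as u u v \<cdot> (br v (u \<odot> u) \<cdot> (as v u u \<cdot> (br u (v \<odot> u) \<cdot> ((idm u \<otimes> c) \<cdot> iv (ru u)))))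
     = br (u \<odot> v) u \<cdot> (iv (as u v u) \<cdot> ((idm u \<otimes> c) \<cdot> iv (ru u)))"
  proof -
    have "(as u u v \<cdot> (br v (u \<odot> u) \<cdot> (as v u u \<cdot> (br u (v \<odot> u) \<cdot> as u v u)))) \<cdot>
        (iv (as u v u) \<cdot> ((idm u \<otimes> c) \<cdot> iv (ru u)))
      = br (u \<odot> v) u \<cdot> (iv (as u v u) \<cdot> ((idm u \<otimes> c) \<cdot> iv (ru u)))"
      using braid_tensor_left_hexagons[of u v u] by simp
    then show ?thesis by simp
  qed
  have Ne: "(idm u \<otimes> e) \<cdot> br (u \<odot> v) u = br U u \<cdot> (e \<otimes> idm u)"
    using braid_nat[of e "idm u"] by simp
  have "snake u v u (e \<cdot> br v u) (br v u \<cdot> c) =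
     ru u \<cdot> ((idm u \<otimes> e) \<cdot> ((idm u \<otimes> br v u) \<cdot> (as u v u \<cdot> ((br v u \<otimes> idm u) \<cdot> ((c \<otimes> idm u) \<cdot> iv (lu u))))))"
    unfolding snake_def I1 I2 by simp
  also have "\<dots> = ru u \<cdot> ((idm u \<otimes> e) \<cdot> (as u u v \<cdot> (br v (u \<odot> u) \<cdot> (as v u u \<cdot>
      (br u (v \<odot> u) \<cdot> ((idm u \<otimes> c) \<cdot> iv (ru u)))))))"
    by (simp add: comp_reassoc3[OF H] inv_lunit_eq comp_reassoc[OF Nc])
  also have "\<dots> = ru u \<cdot> ((idm u \<otimes> e) \<cdot> (br (u \<odot> v) u \<cdot> (iv (as u v u) \<cdot> ((idm u \<otimes> c) \<cdot> iv (ru u)))))"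
    by (simp add: Nd)
  also have "\<dots> = mate v u c u e"
    unfolding mate_def by (simp add: comp_reassoc[OF Ne] comp_reassoc[OF runit_braid])
  finally show ?thesis .
qed

lemma mate_typing:
  assumes "duality_data x xs ev coev" "y \<in> Ob" "arr e" "dm e = y \<odot> x" "cd e = U"
  shows "arr (mate x xs coev y e)" "dm (mate x xs coev y e) = y" "cd (mate x xs coev y e) = xs"
  using assms unfolding duality_data_def mate_def by auto

lemma mate_comp:
  assumes "duality_data x xs ev coev" "arr p" "cd p = y" "arr e" "dm e = y \<odot> x" "cd e = U"
  shows "mate x xs coev y e \<cdot> p = mate x xs coev (dm p) (e \<cdot> (p \<otimes> idm x))"
proof -
  note [simp] = assms[unfolded duality_data_def]
  have [simp]: "y \<in> Ob" using assms(2,3) cd_ob by blast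
  have N1: "iv (ru y) \<cdot> p = (p \<otimes> idm U) \<cdot> iv (ru (dm p))"
    by (rule iso_flip) (use runit_nat[of p] in auto)
  have N2: "(idm y \<otimes> coev) \<cdot> (p \<otimes> idm U) = (p \<otimes> idm (x \<odot> xs)) \<cdot> (idm (dm p) \<otimes> coev)"
    by (simp add: interchange)
  have N3: "iv (as y x xs) \<cdot> (p \<otimes> idm (x \<odot> xs)) = ((p \<otimes> idm x) \<otimes> idm xs) \<cdot> iv (as (dm p) x xs)"
    by (rule iso_flip) (use assoc_nat[of p "idm x" "idm xs"] in auto)
  have N4: "(e \<otimes> idm xs) \<cdot> ((p \<otimes> idm x) \<otimes> idm xs) = (e \<cdot> (p \<otimes> idm x)) \<otimes> idm xs"
    by (simp add: interchange)
  show ?thesis unfolding mate_def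
    by (simp add: N1 comp_reassoc[OF N2] comp_reassoc[OF N3] comp_reassoc[OF N4])
qed

lemma mate_ev_comp:
  assumes "duality_data x xs ev coev" "mate x xs coev xs ev = idm xs" "arr p" "cd p = xs"
  shows "mate x xs coev (dm p) (ev \<cdot> (p \<otimes> idm x)) = p"
proof -
  have "mate x xs coev (dm p) (ev \<cdot> (p \<otimes> idm x)) = mate x xs coev xs ev \<cdot> p"
    using mate_comp[OF assms(1,3,4)] assms(1) unfolding duality_data_def by simp
  then show ?thesis using assms unfolding duality_data_def by simp
qed

lemma assoc_inv_runit:
  assumes "y \<in> Ob" "x \<in> Ob"
  shows "as y U x \<cdot> (iv (ru y) \<otimes> idm x) = idm y \<otimes> iv (lu x)"
proof -
  note [simp] = assms
  have T: "(idm y \<otimes> lu x) \<cdot> as y U x = ru y \<otimes> idm x"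
    using triangle[of y x] by simp
  have "as y U x \<cdot> (iv (ru y) \<otimes> idm x) =
      (idm y \<otimes> iv (lu x)) \<cdot> ((idm y \<otimes> lu x) \<cdot> (as y U x \<cdot> (iv (ru y) \<otimes> idm x)))"
    by simp
  also have "\<dots> = idm y \<otimes> iv (lu x)"
    by (simp add: comp_reassoc[OF T])
  finally show ?thesis .
qed

lemma ev_cancel:
  assumes "duality_data x xs ev coev" "mate x xs coev xs ev = idm xs"
    and "arr p" "arr q" "dm p = dm q" "cd p = xs" "cd q = xs"
    and "ev \<cdot> (p \<otimes> idm x) = ev \<cdot> (q \<otimes> idm x)"
  shows "p = q"
proof -
  have "p = mate x xs coev (dm p) (ev \<cdot> (p \<otimes> idm x))"
    using mate_ev_comp[OF assms(1,2,3,6)] by simp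
  also have "\<dots> = mate x xs coev (dm q) (ev \<cdot> (q \<otimes> idm x))"
    by (simp only: assms(5,8))
  also have "\<dots> = q"
    using mate_ev_comp[OF assms(1,2,4,7)] .
  finally show ?thesis .
qed

lemma ev_mate:
  assumes "duality_data x xs ev coev" "snake x xs x ev coev = idm x"
    and "y \<in> Ob" "arr e" "dm e = y \<odot> x" "cd e = U"
  shows "ev \<cdot> (mate x xs coev y e \<otimes> idm x) = e"
proof -
  note [simp] = assms(3-6) assms(1)[unfolded duality_data_def]
  define R where "R = (iv (as y x xs) \<otimes> idm x) \<cdot> (((idm y \<otimes> coev) \<otimes> idm x) \<cdot> (iv (ru y) \<otimes> idm x))"
  have R: "arr R" "dm R = y \<odot> x" "cd R = ((y \<odot> x) \<odot> xs) \<odot> x"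
    unfolding R_def by auto
  have F1: "ev \<cdot> (lu xs \<otimes> idm x) = lu U \<cdot> ((idm U \<otimes> ev) \<cdot> as U xs x)"
  proof -
    have L: "lu U \<cdot> (idm U \<otimes> ev) = ev \<cdot> lu (xs \<odot> x)"
      using lunit_nat[of ev] by simp
    show ?thesis by (simp add: comp_reassoc[OF L] lunit_tensor)
  qed
  have F2: "as U xs x \<cdot> ((e \<otimes> idm xs) \<otimes> idm x) = (e \<otimes> idm (xs \<odot> x)) \<cdot> as (y \<odot> x) xs x"
    using assoc_nat[of e "idm xs" "idm x"] by simp
  have F3: "(idm U \<otimes> ev) \<cdot> (e \<otimes> idm (xs \<odot> x)) = (e \<otimes> idm U) \<cdot> (idm (y \<odot> x) \<otimes> ev)"
    by (simp add: interchange)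
  have F4: "lu U \<cdot> (e \<otimes> idm U) = e \<cdot> ru (y \<odot> x)"
    using runit_nat[of e] by (simp add: lunit_unit_eq_runit_unit)
  have F5: "as y x U \<cdot> (idm (y \<odot> x) \<otimes> ev) = (idm y \<otimes> (idm x \<otimes> ev)) \<cdot> as y x (xs \<odot> x)"
    using assoc_nat[of "idm y" "idm x" ev] by simp
  have F6: "as y x (xs \<odot> x) \<cdot> (as (y \<odot> x) xs x \<cdot> (iv (as y x xs) \<otimes> idm x)) =
      (idm y \<otimes> as x xs x) \<cdot> as y (x \<odot> xs) x"
    by (simp add: pentagon_inv_left)
  have F7: "as y (x \<odot> xs) x \<cdot> ((idm y \<otimes> coev) \<otimes> idm x) = (idm y \<otimes> (coev \<otimes> idm x)) \<cdot> as y U x"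
    using assoc_nat[of "idm y" coev "idm x"] by simp
  have "ev \<cdot> (mate x xs coev y e \<otimes> idm x) = ev \<cdot> ((lu xs \<otimes> idm x) \<cdot> (((e \<otimes> idm xs) \<otimes> idm x) \<cdot> R))"
    unfolding mate_def R_def by (simp add: interchange)
  also have "\<dots> = e \<cdot> (ru (y \<odot> x) \<cdot> ((idm (y \<odot> x) \<otimes> ev) \<cdot> (as (y \<odot> x) xs x \<cdot> R)))"
    using R by (simp add: comp_reassoc[OF F1] comp_reassoc[OF F2]
        comp_reassoc[OF F3] comp_reassoc[OF F4])
  also have "\<dots> = e \<cdot> ((idm y \<otimes> ru x) \<cdot> ((idm y \<otimes> (idm x \<otimes> ev)) \<cdot> ((idm y \<otimes> as x xs x) \<cdot>
      ((idm y \<otimes> (coev \<otimes> idm x)) \<cdot> (idm y \<otimes> iv (lu x))))))"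
    unfolding R_def
    by (simp add: runit_tensor[symmetric] comp_reassoc[OF F5] comp_reassoc3[OF F6] comp_reassoc[OF F7]
        assoc_inv_runit)
  also have "\<dots> = e \<cdot> (idm y \<otimes> snake x xs x ev coev)"
    unfolding snake_def by (simp add: interchange)
  finally show ?thesis using assms(2) by simp
qed

lemma inv_assoc_inv_lunit:
  assumes "x \<in> Ob" "y \<in> Ob"
  shows "iv (as U x y) \<cdot> iv (lu (x \<odot> y)) = iv (lu x) \<otimes> idm y"
proof -
  have "iv (as U x y) \<cdot> iv (lu (x \<odot> y)) = iv (lu (x \<odot> y) \<cdot> as U x y)"
    using assms by (simp add: inv_of_comp)
  also have "\<dots> = iv (lu x) \<otimes> idm y"
    using assms by (simp add: lunit_tensor inv_tensor)
  finally show ?thesis .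
qed

lemma tensor_mate_coev:
  assumes "duality_data x xs ev coev" "z \<in> Ob" "y \<in> Ob" "arr e" "dm e = y \<odot> x" "cd e = U"
    and "arr c" "dm c = U" "cd c = z \<odot> y"
  shows "(idm z \<otimes> mate x xs coev y e) \<cdot> c = (snake z y x e c \<otimes> idm xs) \<cdot> coev"
proof -
  note [simp] = assms(2-9) assms(1)[unfolded duality_data_def]
  have G0: "idm z \<otimes> mate x xs coev y e = (idm z \<otimes> lu xs) \<cdot> ((idm z \<otimes> (e \<otimes> idm xs)) \<cdot>
      ((idm z \<otimes> iv (as y x xs)) \<cdot> ((idm z \<otimes> (idm y \<otimes> coev)) \<cdot> (idm z \<otimes> iv (ru y)))))"
    unfolding mate_def by (simp add: interchange)
  have G1: "(idm z \<otimes> iv (ru y)) \<cdot> c = as z y U \<cdot> ((c \<otimes> idm U) \<cdot> iv (ru U))"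
  proof -
    have "iv (ru (z \<odot> y)) \<cdot> c = (c \<otimes> idm U) \<cdot> iv (ru U)"
      by (rule iso_flip) (use runit_nat[of c] in auto)
    then show ?thesis by (simp add: tensor_inv_runit)
  qed
  have G2: "(idm z \<otimes> (idm y \<otimes> coev)) \<cdot> as z y U = as z y (x \<odot> xs) \<cdot> (idm (z \<odot> y) \<otimes> coev)"
    using assoc_nat[of "idm z" "idm y" coev] by simp
  have G3: "(idm z \<otimes> iv (as y x xs)) \<cdot> as z y (x \<odot> xs) =
      as z (y \<odot> x) xs \<cdot> ((as z y x \<otimes> idm xs) \<cdot> iv (as (z \<odot> y) x xs))"
    by (simp add: pentagon_inv_right)
  have G4: "(idm z \<otimes> (e \<otimes> idm xs)) \<cdot> as z (y \<odot> x) xs = as z U xs \<cdot> ((idm z \<otimes> e) \<otimes> idm xs)"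
    using assoc_nat[of "idm z" e "idm xs"] by simp
  have G5: "(idm z \<otimes> lu xs) \<cdot> as z U xs = ru z \<otimes> idm xs"
    using triangle[of z xs] by simp
  have G6: "(idm (z \<odot> y) \<otimes> coev) \<cdot> (c \<otimes> idm U) = (c \<otimes> idm (x \<odot> xs)) \<cdot> (idm U \<otimes> coev)"
    by (simp add: interchange)
  have G7: "iv (as (z \<odot> y) x xs) \<cdot> (c \<otimes> idm (x \<odot> xs)) = ((c \<otimes> idm x) \<otimes> idm xs) \<cdot> iv (as U x xs)"
    by (rule iso_flip) (use assoc_nat[of c "idm x" "idm xs"] in auto)
  have G8: "(idm U \<otimes> coev) \<cdot> iv (ru U) = iv (lu (x \<odot> xs)) \<cdot> coev"
  proof -
    have "iv (lu (x \<odot> xs)) \<cdot> coev = (idm U \<otimes> coev) \<cdot> iv (lu U)"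
      by (rule iso_flip) (use lunit_nat[of coev] in auto)
    then show ?thesis by (simp add: lunit_unit_eq_runit_unit)
  qed
  have G9: "iv (as U x xs) \<cdot> iv (lu (x \<odot> xs)) = iv (lu x) \<otimes> idm xs"
    by (simp add: inv_assoc_inv_lunit)
  have "(idm z \<otimes> mate x xs coev y e) \<cdot> c = (ru z \<otimes> idm xs) \<cdot> (((idm z \<otimes> e) \<otimes> idm xs) \<cdot>
      ((as z y x \<otimes> idm xs) \<cdot> (iv (as (z \<odot> y) x xs) \<cdot> ((idm (z \<odot> y) \<otimes> coev) \<cdot>
      ((c \<otimes> idm U) \<cdot> iv (ru U))))))"
    unfolding G0 by (simp add: G1 comp_reassoc[OF G2] comp_reassoc[OF G3] comp_reassoc[OF G4]
        comp_reassoc[OF G5])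
  also have "\<dots> = (ru z \<otimes> idm xs) \<cdot> (((idm z \<otimes> e) \<otimes> idm xs) \<cdot> ((as z y x \<otimes> idm xs) \<cdot>
      (((c \<otimes> idm x) \<otimes> idm xs) \<cdot> ((iv (lu x) \<otimes> idm xs) \<cdot> coev))))"
    by (simp add: comp_reassoc[OF G6] comp_reassoc[OF G7] G8 comp_reassoc[OF G9])
  also have "\<dots> = (snake z y x e c \<otimes> idm xs) \<cdot> coev"
    unfolding snake_def by (simp add: interchange comp_reassoc[OF interchange])
  finally show ?thesis .
qed

lemma mate_transport:
  assumes "duality_data x xs1 ev1 coev1" "duality_data x xs2 ev2 coev2"
    and "arr p" "dm p = xs1" "cd p = xs2" "(idm x \<otimes> p) \<cdot> coev1 = coev2"
    and "y \<in> Ob" "arr e" "dm e = y \<odot> x" "cd e = U"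
  shows "p \<cdot> mate x xs1 coev1 y e = mate x xs2 coev2 y e"
proof -
  note [simp] = assms(3-5,7-10) assms(1,2)[unfolded duality_data_def]
  have T1: "p \<cdot> lu xs1 = lu xs2 \<cdot> (idm U \<otimes> p)"
    using lunit_nat[of p] by simp
  have T2: "(idm U \<otimes> p) \<cdot> (e \<otimes> idm xs1) = (e \<otimes> idm xs2) \<cdot> (idm (y \<odot> x) \<otimes> p)"
    by (simp add: interchange)
  have T3: "(idm (y \<odot> x) \<otimes> p) \<cdot> iv (as y x xs1) = iv (as y x xs2) \<cdot> (idm y \<otimes> (idm x \<otimes> p))"
    by (rule iso_flip[symmetric]) (use assoc_nat[of "idm y" "idm x" p] in auto)
  have T4: "(idm y \<otimes> (idm x \<otimes> p)) \<cdot> (idm y \<otimes> coev1) = idm y \<otimes> coev2"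
    using assms(6) by (simp add: interchange)
  show ?thesis unfolding mate_def
    by (simp add: comp_reassoc[OF T1] comp_reassoc[OF T2] comp_reassoc[OF T3] comp_reassoc[OF T4])
qed

end

lemma mc_op_simps[simp]:
  "mc_obj (mc_op C) = mc_obj C" "mc_arr (mc_op C) = mc_arr C"
  "mc_dom (mc_op C) = mc_cod C" "mc_cod (mc_op C) = mc_dom C" "mc_cmp (mc_op C) g f = mc_cmp C f g"
  "mc_id (mc_op C) = mc_id C" "mc_tens (mc_op C) = mc_tens C" "mc_tensm (mc_op C) = mc_tensm C"
  "mc_unit (mc_op C) = mc_unit C" "mc_assoc (mc_op C) a b c = mc_inv C (mc_assoc C a b c)"
  "mc_lunit (mc_op C) a = mc_inv C (mc_lunit C a)" "mc_runit (mc_op C) a = mc_inv C (mc_runit C a)"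
  "mc_braid (mc_op C) a b = mc_braid C b a"
  by (simp_all add: mc_op_def)

lemma mc_hom_op[simp]: "mc_hom (mc_op C) a b = mc_hom C b a"
  unfolding mc_hom_def by auto

lemma mc_iso_op[simp]: "mc_iso (mc_op C) f = mc_iso C f"
  unfolding mc_iso_def by auto

locale anti_involutive = sym_monoidal C for C :: "('o, 'm, 'x) mcat_scheme" +
  fixes d0 :: "'o \<Rightarrow> 'o" and d1 :: "'m \<Rightarrow> 'm" and dmu :: "'o \<Rightarrow> 'o \<Rightarrow> 'm" and deps :: "'m"
    and eta :: "'o \<Rightarrow> 'm"
  assumes AIC: "anti_involutive_category C d0 d1 dmu deps eta"
begin

abbreviation Do where "Do \<equiv> d0"
abbreviation D where "D \<equiv> d1"
abbreviation mu where "mu \<equiv> dmu"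
abbreviation ep where "ep \<equiv> deps"

lemma sym_monoidal_d: "sym_monoidal_functor C (mc_op C) d0 d1 dmu deps"
  using AIC unfolding anti_involutive_category_def by auto

lemma functor_d: "mc_functor C (mc_op C) d0 d1"
  using sym_monoidal_d unfolding sym_monoidal_functor_def by auto

lemma Do_ob[simp]: "a \<in> Ob \<Longrightarrow> Do a \<in> Ob"
  using functor_d unfolding mc_functor_def by auto

lemma D_typing: "arr f \<Longrightarrow> arr (D f) \<and> dm (D f) = Do (cd f) \<and> cd (D f) = Do (dm f)"
  using functor_d unfolding mc_functor_def mc_hom_def by auto
lemma arr_D[simp]: "arr f \<Longrightarrow> arr (D f)"
  and dm_D[simp]: "arr f \<Longrightarrow> dm (D f) = Do (cd f)"
  and cd_D[simp]: "arr f \<Longrightarrow> cd (D f) = Do (dm f)"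
  using D_typing by auto

lemma D_id[simp]: "a \<in> Ob \<Longrightarrow> D (idm a) = idm (Do a)"
  using functor_d unfolding mc_functor_def by auto

lemma D_comp: "arr f \<Longrightarrow> arr g \<Longrightarrow> dm g = cd f \<Longrightarrow> D (g \<cdot> f) = D f \<cdot> D g"
  using functor_d unfolding mc_functor_def by auto

lemma ep_typing: "arr ep \<and> dm ep = Do U \<and> cd ep = U \<and> iso ep"
  using sym_monoidal_d unfolding sym_monoidal_functor_def mc_hom_def by auto
lemma arr_ep[simp]: "arr ep"
  and dm_ep[simp]: "dm ep = Do U"
  and cd_ep[simp]: "cd ep = U"
  and iso_ep[simp]: "iso ep"
  using ep_typing by auto

lemma mu_typing: "a \<in> Ob \<Longrightarrow> b \<in> Ob \<Longrightarrow>
    arr (mu a b) \<and> dm (mu a b) = Do (a \<odot> b) \<and> cd (mu a b) = Do a \<odot> Do b \<and> iso (mu a b)"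
  using sym_monoidal_d unfolding sym_monoidal_functor_def mc_hom_def by auto
lemma arr_mu[simp]: "a \<in> Ob \<Longrightarrow> b \<in> Ob \<Longrightarrow> arr (mu a b)"
  and dm_mu[simp]: "a \<in> Ob \<Longrightarrow> b \<in> Ob \<Longrightarrow> dm (mu a b) = Do (a \<odot> b)"
  and cd_mu[simp]: "a \<in> Ob \<Longrightarrow> b \<in> Ob \<Longrightarrow> cd (mu a b) = Do a \<odot> Do b"
  and iso_mu[simp]: "a \<in> Ob \<Longrightarrow> b \<in> Ob \<Longrightarrow> iso (mu a b)"
  using mu_typing by auto

lemma mu_nat: "arr f \<Longrightarrow> arr g \<Longrightarrow> mu (dm f) (dm g) \<cdot> D (f \<otimes> g) = (D f \<otimes> D g) \<cdot> mu (cd f) (cd g)"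
  using sym_monoidal_d unfolding sym_monoidal_functor_def by auto

lemma mu_assoc: "a \<in> Ob \<Longrightarrow> b \<in> Ob \<Longrightarrow> c \<in> Ob \<Longrightarrow>
    ((mu a b \<otimes> idm (Do c)) \<cdot> mu (a \<odot> b) c) \<cdot> D (as a b c) =
    (iv (as (Do a) (Do b) (Do c)) \<cdot> (idm (Do a) \<otimes> mu b c)) \<cdot> mu a (b \<odot> c)"
  using sym_monoidal_d unfolding sym_monoidal_functor_def by auto

lemma mu_lunit: "a \<in> Ob \<Longrightarrow> ((ep \<otimes> idm (Do a)) \<cdot> mu U a) \<cdot> D (lu a) = iv (lu (Do a))"
  using sym_monoidal_d unfolding sym_monoidal_functor_def by auto

lemma mu_runit: "a \<in> Ob \<Longrightarrow> ((idm (Do a) \<otimes> ep) \<cdot> mu a U) \<cdot> D (ru a) = iv (ru (Do a))"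
  using sym_monoidal_d unfolding sym_monoidal_functor_def by auto

lemma mu_braid: "a \<in> Ob \<Longrightarrow> b \<in> Ob \<Longrightarrow> mu a b \<cdot> D (br a b) = br (Do b) (Do a) \<cdot> mu b a"
  using sym_monoidal_d unfolding sym_monoidal_functor_def by auto

lemma eta_typing: "a \<in> Ob \<Longrightarrow> arr (eta a) \<and> dm (eta a) = a \<and> cd (eta a) = Do (Do a) \<and> iso (eta a)"
  using AIC unfolding anti_involutive_category_def mc_hom_def by auto
lemma arr_eta[simp]: "a \<in> Ob \<Longrightarrow> arr (eta a)"
  and dm_eta[simp]: "a \<in> Ob \<Longrightarrow> dm (eta a) = a"
  and cd_eta[simp]: "a \<in> Ob \<Longrightarrow> cd (eta a) = Do (Do a)"
  and iso_eta[simp]: "a \<in> Ob \<Longrightarrow> iso (eta a)"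
  using eta_typing by auto

lemma eta_nat: "arr f \<Longrightarrow> eta (cd f) \<cdot> f = D (D f) \<cdot> eta (dm f)"
  using AIC unfolding anti_involutive_category_def by auto

lemma eta_tensor: "a \<in> Ob \<Longrightarrow> b \<in> Ob \<Longrightarrow>
    eta (a \<odot> b) = (D (mu a b) \<cdot> iv (mu (Do a) (Do b))) \<cdot> (eta a \<otimes> eta b)"
  using AIC unfolding anti_involutive_category_def by auto

lemma eta_unit: "eta U = D ep \<cdot> iv ep"
  using AIC unfolding anti_involutive_category_def by auto

lemma iso_D[simp]: "iso f \<Longrightarrow> iso (D f)"
  by (rule isoI[where g="D (iv f)"]) (auto simp: iso_is_arr D_comp[symmetric])

lemma inv_D: "iso f \<Longrightarrow> iv (D f) = D (iv f)"
  by (rule inv_eqI) (auto simp: iso_is_arr D_comp[symmetric])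

lemma D_lu:
  assumes "a \<in> Ob"
  shows "D (lu a) = iv (mu U a) \<cdot> ((iv ep \<otimes> idm (Do a)) \<cdot> iv (lu (Do a)))"
proof -
  have "D (lu a) = iv ((ep \<otimes> idm (Do a)) \<cdot> mu U a) \<cdot> iv (lu (Do a))"
    by (rule iso_solve_left) (use assms mu_lunit[of a] in auto)
  then show ?thesis using assms by (simp add: inv_of_comp inv_tensor)
qed

lemma D_inv_lu:
  assumes "a \<in> Ob"
  shows "D (iv (lu a)) = lu (Do a) \<cdot> ((ep \<otimes> idm (Do a)) \<cdot> mu U a)"
proof -
  have "D (lu a) = iv ((ep \<otimes> idm (Do a)) \<cdot> mu U a) \<cdot> iv (lu (Do a))"
    by (rule iso_solve_left) (use assms mu_lunit[of a] in auto)
  then have "iv (D (lu a)) = lu (Do a) \<cdot> ((ep \<otimes> idm (Do a)) \<cdot> mu U a)"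
    using assms by (simp add: inv_of_comp)
  then show ?thesis using assms by (simp add: inv_D)
qed

lemma D_ru:
  assumes "a \<in> Ob"
  shows "D (ru a) = iv (mu a U) \<cdot> ((idm (Do a) \<otimes> iv ep) \<cdot> iv (ru (Do a)))"
proof -
  have "D (ru a) = iv ((idm (Do a) \<otimes> ep) \<cdot> mu a U) \<cdot> iv (ru (Do a))"
    by (rule iso_solve_left) (use assms mu_runit[of a] in auto)
  then show ?thesis using assms by (simp add: inv_of_comp inv_tensor)
qed

lemma D_inv_ru:
  assumes "a \<in> Ob"
  shows "D (iv (ru a)) = ru (Do a) \<cdot> ((idm (Do a) \<otimes> ep) \<cdot> mu a U)"
proof -
  have "D (ru a) = iv ((idm (Do a) \<otimes> ep) \<cdot> mu a U) \<cdot> iv (ru (Do a))"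
    by (rule iso_solve_left) (use assms mu_runit[of a] in auto)
  then have "iv (D (ru a)) = ru (Do a) \<cdot> ((idm (Do a) \<otimes> ep) \<cdot> mu a U)"
    using assms by (simp add: inv_of_comp)
  then show ?thesis using assms by (simp add: inv_D)
qed

lemma D_as:
  assumes "a \<in> Ob" "b \<in> Ob" "c \<in> Ob"
  shows "D (as a b c) = iv (mu (a \<odot> b) c) \<cdot> ((iv (mu a b) \<otimes> idm (Do c)) \<cdot>
    (iv (as (Do a) (Do b) (Do c)) \<cdot> ((idm (Do a) \<otimes> mu b c) \<cdot> mu a (b \<odot> c))))"
proof -
  have "D (as a b c) = iv ((mu a b \<otimes> idm (Do c)) \<cdot> mu (a \<odot> b) c) \<cdot>
      ((iv (as (Do a) (Do b) (Do c)) \<cdot> (idm (Do a) \<otimes> mu b c)) \<cdot> mu a (b \<odot> c))"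
    by (rule iso_solve_left) (use assms mu_assoc[of a b c] in auto)
  then show ?thesis using assms by (simp add: inv_of_comp inv_tensor)
qed

lemma D_inv_as:
  assumes "a \<in> Ob" "b \<in> Ob" "c \<in> Ob"
  shows "D (iv (as a b c)) = iv (mu a (b \<odot> c)) \<cdot> ((idm (Do a) \<otimes> iv (mu b c)) \<cdot>
    (as (Do a) (Do b) (Do c) \<cdot> ((mu a b \<otimes> idm (Do c)) \<cdot> mu (a \<odot> b) c)))"
proof -
  have "D (iv (as a b c)) = iv (D (as a b c))"
    using assms by (simp add: inv_D)
  then show ?thesis
    unfolding D_as[OF assms] using assms by (simp add: inv_of_comp inv_tensor)
qed

lemma mu_nat_inv:
  assumes "arr f" "arr g"
  shows "D (f \<otimes> g) \<cdot> iv (mu (cd f) (cd g)) = iv (mu (dm f) (dm g)) \<cdot> (D f \<otimes> D g)"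
  by (rule iso_flip[symmetric]) (use mu_nat[OF assms] assms in auto)

lemma D_snake:
  assumes "x \<in> Ob" "y \<in> Ob" "arr e" "dm e = y \<odot> x" "cd e = U" "arr c" "dm c = U" "cd c = x \<odot> y"
  shows "D (snake x y x e c) =
    mate (Do y) (Do x) (mu y x \<cdot> (D e \<cdot> iv ep)) (Do x) (ep \<cdot> (D c \<cdot> iv (mu x y)))"
proof -
  note [simp] = assms
  have N1: "D (idm x \<otimes> e) \<cdot> iv (mu x U) = iv (mu x (y \<odot> x)) \<cdot> (idm (Do x) \<otimes> D e)"
    using mu_nat_inv[of "idm x" e] by simp
  have N2: "D (c \<otimes> idm x) \<cdot> iv (mu (x \<odot> y) x) = iv (mu U x) \<cdot> (D c \<otimes> idm (Do x))"
    using mu_nat_inv[of c "idm x"] by simp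
  have "D (snake x y x e c) =
      D (iv (lu x)) \<cdot> (D (c \<otimes> idm x) \<cdot> (D (as x y x) \<cdot> (D (idm x \<otimes> e) \<cdot> D (ru x))))"
    unfolding snake_def by (simp add: D_comp)
  also have "\<dots> = lu (Do x) \<cdot> ((ep \<otimes> idm (Do x)) \<cdot> ((D c \<otimes> idm (Do x)) \<cdot>
      ((iv (mu x y) \<otimes> idm (Do x)) \<cdot> (iv (as (Do x) (Do y) (Do x)) \<cdot> ((idm (Do x) \<otimes> mu y x) \<cdot>
      ((idm (Do x) \<otimes> D e) \<cdot> ((idm (Do x) \<otimes> iv ep) \<cdot> iv (ru (Do x)))))))))"
    by (simp add: D_ru D_as D_inv_lu comp_reassoc[OF N1] comp_reassoc[OF N2])
  also have "\<dots> = mate (Do y) (Do x) (mu y x \<cdot> (D e \<cdot> iv ep)) (Do x) (ep \<cdot> (D c \<cdot> iv (mu x y)))"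
    unfolding mate_def by (simp add: interchange comp_reassoc[OF interchange])
  finally show ?thesis .
qed

lemma D_mate:
  assumes "x \<in> Ob" "y \<in> Ob" "arr e" "dm e = y \<odot> x" "cd e = U" "arr c" "dm c = U" "cd c = x \<odot> y"
  shows "D (mate x y c y e) =
    snake (Do y) (Do x) (Do y) (ep \<cdot> (D c \<cdot> iv (mu x y))) (mu y x \<cdot> (D e \<cdot> iv ep))"
proof -
  note [simp] = assms
  have N1: "D (e \<otimes> idm y) \<cdot> iv (mu U y) = iv (mu (y \<odot> x) y) \<cdot> (D e \<otimes> idm (Do y))"
    using mu_nat_inv[of e "idm y"] by simp
  have N2: "D (idm y \<otimes> c) \<cdot> iv (mu y (x \<odot> y)) = iv (mu y U) \<cdot> (idm (Do y) \<otimes> D c)"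
    using mu_nat_inv[of "idm y" c] by simp
  have "D (mate x y c y e) =
      D (iv (ru y)) \<cdot> (D (idm y \<otimes> c) \<cdot> (D (iv (as y x y)) \<cdot> (D (e \<otimes> idm y) \<cdot> D (lu y))))"
    unfolding mate_def by (simp add: D_comp)
  also have "\<dots> = ru (Do y) \<cdot> ((idm (Do y) \<otimes> ep) \<cdot> ((idm (Do y) \<otimes> D c) \<cdot>
      ((idm (Do y) \<otimes> iv (mu x y)) \<cdot> (as (Do y) (Do x) (Do y) \<cdot> ((mu y x \<otimes> idm (Do y)) \<cdot>
      ((D e \<otimes> idm (Do y)) \<cdot> ((iv ep \<otimes> idm (Do y)) \<cdot> iv (lu (Do y)))))))))"
    by (simp add: D_lu D_inv_as D_inv_ru comp_reassoc[OF N1] comp_reassoc[OF N2])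
  also have "\<dots> = snake (Do y) (Do x) (Do y) (ep \<cdot> (D c \<cdot> iv (mu x y))) (mu y x \<cdot> (D e \<cdot> iv ep))"
    unfolding snake_def by (simp add: interchange comp_reassoc[OF interchange])
  finally show ?thesis .
qed

end

locale anti_involutive_duals =
  anti_involutive C d0 d1 dmu deps eta for C :: "('o, 'm, 'x) mcat_scheme" and d0 d1 dmu deps eta +
  fixes dual :: "'o \<Rightarrow> 'o" and ev coev :: "'o \<Rightarrow> 'm"
  assumes duals: "dual_choice C dual ev coev"
begin

lemma dual_ob[simp]: "a \<in> Ob \<Longrightarrow> dual a \<in> Ob"
  using duals unfolding dual_choice_def by auto

lemma ev_typing: "a \<in> Ob \<Longrightarrow> arr (ev a) \<and> dm (ev a) = dual a \<odot> a \<and> cd (ev a) = U"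
  using duals unfolding dual_choice_def mc_hom_def by auto
lemma arr_ev[simp]: "a \<in> Ob \<Longrightarrow> arr (ev a)"
  and dm_ev[simp]: "a \<in> Ob \<Longrightarrow> dm (ev a) = dual a \<odot> a"
  and cd_ev[simp]: "a \<in> Ob \<Longrightarrow> cd (ev a) = U"
  using ev_typing by auto

lemma coev_typing: "a \<in> Ob \<Longrightarrow> arr (coev a) \<and> dm (coev a) = U \<and> cd (coev a) = a \<odot> dual a"
  using duals unfolding dual_choice_def mc_hom_def by auto
lemma arr_coev[simp]: "a \<in> Ob \<Longrightarrow> arr (coev a)"
  and dm_coev[simp]: "a \<in> Ob \<Longrightarrow> dm (coev a) = U"
  and cd_coev[simp]: "a \<in> Ob \<Longrightarrow> cd (coev a) = a \<odot> dual a"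
  using coev_typing by auto

lemma zigzag_snake[simp]: "a \<in> Ob \<Longrightarrow> snake a (dual a) a (ev a) (coev a) = idm a"
  using duals unfolding dual_choice_def snake_def by auto

lemma zigzag_mate[simp]: "a \<in> Ob \<Longrightarrow> mate a (dual a) (coev a) (dual a) (ev a) = idm (dual a)"
  using duals unfolding dual_choice_def mate_def by auto

lemma duality_data_dual[simp]: "a \<in> Ob \<Longrightarrow> duality_data a (dual a) (ev a) (coev a)"
  unfolding duality_data_def by auto

abbreviation dev where "dev a \<equiv> d_ev C d0 d1 dmu deps dual coev a"
abbreviation dcoev where "dcoev a \<equiv> d_coev C d0 d1 dmu deps dual ev a"
abbreviation phi where "phi a \<equiv> canon_iso C d0 d1 dmu deps dual ev coev a"

definition d_ev' where "d_ev' a = ep \<cdot> (D (coev a) \<cdot> iv (mu a (dual a)))"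
definition d_coev' where "d_coev' a = mu (dual a) a \<cdot> (D (ev a) \<cdot> iv ep)"

lemma d_ev'_typing[simp]:
  "a \<in> Ob \<Longrightarrow> arr (d_ev' a)" "a \<in> Ob \<Longrightarrow> dm (d_ev' a) = Do a \<odot> Do (dual a)" "a \<in> Ob \<Longrightarrow> cd (d_ev' a) = U"
  unfolding d_ev'_def by auto

lemma d_coev'_typing[simp]:
  "a \<in> Ob \<Longrightarrow> arr (d_coev' a)" "a \<in> Ob \<Longrightarrow> dm (d_coev' a) = U"
  "a \<in> Ob \<Longrightarrow> cd (d_coev' a) = Do (dual a) \<odot> Do a"
  unfolding d_coev'_def by auto

lemma d_ev_eq: "a \<in> Ob \<Longrightarrow> dev a = d_ev' a \<cdot> br (Do (dual a)) (Do a)"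
  unfolding d_ev_def d_ev'_def by simp

lemma d_coev_eq: "a \<in> Ob \<Longrightarrow> dcoev a = br (Do (dual a)) (Do a) \<cdot> d_coev' a"
  unfolding d_coev_def d_coev'_def by simp

lemma d_ev_typing[simp]:
  "a \<in> Ob \<Longrightarrow> arr (dev a)" "a \<in> Ob \<Longrightarrow> dm (dev a) = Do (dual a) \<odot> Do a" "a \<in> Ob \<Longrightarrow> cd (dev a) = U"
  by (auto simp: d_ev_eq)

lemma d_coev_typing[simp]:
  "a \<in> Ob \<Longrightarrow> arr (dcoev a)" "a \<in> Ob \<Longrightarrow> dm (dcoev a) = U" "a \<in> Ob \<Longrightarrow> cd (dcoev a) = Do a \<odot> Do (dual a)"
  by (auto simp: d_coev_eq)

lemma duality_data_d[simp]: "a \<in> Ob \<Longrightarrow> duality_data (Do a) (Do (dual a)) (dev a) (dcoev a)"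
  unfolding duality_data_def by auto

lemma d_zigzag_snake[simp]:
  assumes "a \<in> Ob"
  shows "snake (Do a) (Do (dual a)) (Do a) (dev a) (dcoev a) = idm (Do a)"
proof -
  note [simp] = assms
  have "idm (Do a) = D (snake a (dual a) a (ev a) (coev a))"
    by simp
  also have "\<dots> = mate (Do (dual a)) (Do a) (d_coev' a) (Do a) (d_ev' a)"
    unfolding d_ev'_def d_coev'_def by (rule D_snake) auto
  also have "\<dots> = snake (Do a) (Do (dual a)) (Do a) (d_ev' a \<cdot> br (Do (dual a)) (Do a))
      (br (Do (dual a)) (Do a) \<cdot> d_coev' a)"
    by (rule snake_braid_eq_mate[symmetric]) auto
  finally show ?thesis by (simp add: d_ev_eq d_coev_eq)
qed

lemma d_zigzag_mate[simp]:
  assumes "a \<in> Ob"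
  shows "mate (Do a) (Do (dual a)) (dcoev a) (Do (dual a)) (dev a) = idm (Do (dual a))"
proof -
  note [simp] = assms
  have "idm (Do (dual a)) = D (mate a (dual a) (coev a) (dual a) (ev a))"
    by simp
  also have "\<dots> = snake (Do (dual a)) (Do a) (Do (dual a)) (d_ev' a) (d_coev' a)"
    unfolding d_ev'_def d_coev'_def by (rule D_mate) auto
  also have "\<dots> = snake (Do (dual a)) (Do a) (Do (dual a)) (dev a \<cdot> br (Do a) (Do (dual a)))
      (br (Do a) (Do (dual a)) \<cdot> dcoev a)"
    by (simp add: d_ev_eq d_coev_eq)
  also have "\<dots> = mate (Do a) (Do (dual a)) (dcoev a) (Do (dual a)) (dev a)"
    by (rule snake_braid_eq_mate) auto
  finally show ?thesis by simp
qed

lemma ev_cancel_dual: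
  assumes "a \<in> Ob" "arr p" "arr q" "dm p = dm q" "cd p = dual a" "cd q = dual a"
    and "ev a \<cdot> (p \<otimes> idm a) = ev a \<cdot> (q \<otimes> idm a)"
  shows "p = q"
proof -
  have "duality_data a (dual a) (ev a) (coev a)"
    "mate a (dual a) (coev a) (dual a) (ev a) = idm (dual a)"
    using assms(1) by simp_all
  then show ?thesis
    using assms(2-7) by (rule ev_cancel)
qed

definition canon where
  "canon a = mate (Do a) (dual (Do a)) (coev (Do a)) (Do (dual a)) (dev a)"

lemma canon_typing[simp]:
  "a \<in> Ob \<Longrightarrow> arr (canon a)" "a \<in> Ob \<Longrightarrow> dm (canon a) = Do (dual a)" "a \<in> Ob \<Longrightarrow> cd (canon a) = dual (Do a)"
  unfolding canon_def by (auto intro: mate_typing[OF duality_data_dual])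

lemma ev_canon: "a \<in> Ob \<Longrightarrow> ev (Do a) \<cdot> (canon a \<otimes> idm (Do a)) = dev a"
  unfolding canon_def by (rule ev_mate) auto

lemma canon_coev:
  assumes "a \<in> Ob"
  shows "(idm (Do a) \<otimes> canon a) \<cdot> dcoev a = coev (Do a)"
proof -
  have "(idm (Do a) \<otimes> canon a) \<cdot> dcoev a =
      (snake (Do a) (Do (dual a)) (Do a) (dev a) (dcoev a) \<otimes> idm (dual (Do a))) \<cdot> coev (Do a)"
    unfolding canon_def by (rule tensor_mate_coev[where ev="ev (Do a)"]) (use assms in auto)
  then show ?thesis using assms by simp
qed

lemma canon_iso_eq:
  assumes "a \<in> Ob"
  shows "phi a = canon a"
  unfolding canon_iso_def
proof (rule the_equality)
  show "canon a \<in> mc_hom C (Do (dual a)) (dual (Do a)) \<and> ev (Do a) \<cdot> (canon a \<otimes> idm (Do a)) = dev a \<and>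
      (idm (Do a) \<otimes> canon a) \<cdot> dcoev a = coev (Do a)"
    using assms ev_canon canon_coev unfolding mc_hom_def by auto
next
  fix p
  assume "p \<in> mc_hom C (Do (dual a)) (dual (Do a)) \<and> ev (Do a) \<cdot> (p \<otimes> idm (Do a)) = dev a \<and>
      (idm (Do a) \<otimes> p) \<cdot> dcoev a = coev (Do a)"
  then have p: "arr p" "dm p = Do (dual a)" "cd p = dual (Do a)" "ev (Do a) \<cdot> (p \<otimes> idm (Do a)) = dev a"
    unfolding mc_hom_def by auto
  show "p = canon a"
    by (rule ev_cancel_dual[of "Do a"]) (use assms p ev_canon in simp_all)
qed

lemma iso_canon:
  assumes "a \<in> Ob"
  shows "iso (canon a)"
proof -
  note [simp] = assms
  define q where "q = mate (Do a) (Do (dual a)) (dcoev a) (dual (Do a)) (ev (Do a))"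
  have q: "arr q" "dm q = dual (Do a)" "cd q = Do (dual a)"
    unfolding q_def by (auto intro: mate_typing[OF duality_data_d])
  have "canon a \<cdot> q = mate (Do a) (dual (Do a)) (coev (Do a)) (dual (Do a)) (ev (Do a))"
    unfolding q_def
    by (rule mate_transport[of "Do a" "Do (dual a)" "dev a" "dcoev a" "dual (Do a)" "ev (Do a)" "coev (Do a)"])
      (auto simp: canon_coev)
  then have right_inv: "canon a \<cdot> q = idm (dual (Do a))"
    by simp
  have "q \<cdot> canon a =
      mate (Do a) (Do (dual a)) (dcoev a) (Do (dual a)) (ev (Do a) \<cdot> (canon a \<otimes> idm (Do a)))"
    unfolding q_def using mate_comp[OF duality_data_d[OF assms], of "canon a" "dual (Do a)" "ev (Do a)"]
    by simp
  then have left_inv: "q \<cdot> canon a = idm (Do (dual a))"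
    by (simp add: ev_canon)
  show ?thesis
    by (rule isoI[where g=q]) (use q left_inv right_inv in auto)
qed

definition dual_arr where
  "dual_arr f = mate (dm f) (dual (dm f)) (coev (dm f)) (dual (cd f))
    (ev (cd f) \<cdot> (idm (dual (cd f)) \<otimes> f))"

lemma dual_arr_typing[simp]:
  "arr f \<Longrightarrow> arr (dual_arr f)" "arr f \<Longrightarrow> dm (dual_arr f) = dual (cd f)"
  "arr f \<Longrightarrow> cd (dual_arr f) = dual (dm f)"
  unfolding dual_arr_def by (auto intro: mate_typing[OF duality_data_dual])

lemma ev_dual_arr: "arr f \<Longrightarrow> ev (dm f) \<cdot> (dual_arr f \<otimes> idm (dm f)) = ev (cd f) \<cdot> (idm (dual (cd f)) \<otimes> f)"
  unfolding dual_arr_def by (rule ev_mate) auto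

lemma dual_arr_unique:
  assumes "arr f" "arr p" "dm p = dual (cd f)" "cd p = dual (dm f)"
    and "ev (dm f) \<cdot> (p \<otimes> idm (dm f)) = ev (cd f) \<cdot> (idm (dual (cd f)) \<otimes> f)"
  shows "p = dual_arr f"
  by (rule ev_cancel_dual[of "dm f"]) (use assms ev_dual_arr in simp_all)

lemma dual_mor_eq:
  assumes "arr f"
  shows "dual_mor C dual ev f = dual_arr f"
  unfolding dual_mor_def
proof (rule the_equality)
  show "dual_arr f \<in> mc_hom C (dual (cd f)) (dual (dm f)) \<and>
      ev (dm f) \<cdot> (dual_arr f \<otimes> idm (dm f)) = ev (cd f) \<cdot> (idm (dual (cd f)) \<otimes> f)"
    using assms ev_dual_arr unfolding mc_hom_def by auto
next
  fix g
  assume "g \<in> mc_hom C (dual (cd f)) (dual (dm f)) \<and>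
      ev (dm f) \<cdot> (g \<otimes> idm (dm f)) = ev (cd f) \<cdot> (idm (dual (cd f)) \<otimes> f)"
  then show "g = dual_arr f"
    using dual_arr_unique[OF assms, of g] unfolding mc_hom_def by auto
qed

lemma dual_arr_id: "a \<in> Ob \<Longrightarrow> dual_arr (idm a) = idm (dual a)"
  by (rule dual_arr_unique[symmetric]) auto

lemma dual_arr_comp:
  assumes "arr f" "arr g" "dm g = cd f"
  shows "dual_arr (g \<cdot> f) = dual_arr f \<cdot> dual_arr g"
proof (rule dual_arr_unique[symmetric])
  note [simp] = assms
  have F: "ev (dm f) \<cdot> (dual_arr f \<otimes> idm (dm f)) = ev (cd f) \<cdot> (idm (dual (cd f)) \<otimes> f)"
    by (rule ev_dual_arr) simp
  have G: "ev (cd f) \<cdot> (dual_arr g \<otimes> idm (cd f)) = ev (cd g) \<cdot> (idm (dual (cd g)) \<otimes> g)"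
    using ev_dual_arr[of g] by simp
  have I: "(idm (dual (cd f)) \<otimes> f) \<cdot> (dual_arr g \<otimes> idm (dm f)) =
      (dual_arr g \<otimes> idm (cd f)) \<cdot> (idm (dual (cd g)) \<otimes> f)"
    by (simp add: interchange)
  have "ev (dm f) \<cdot> ((dual_arr f \<cdot> dual_arr g) \<otimes> idm (dm f)) =
      ev (dm f) \<cdot> ((dual_arr f \<otimes> idm (dm f)) \<cdot> (dual_arr g \<otimes> idm (dm f)))"
    by (simp add: interchange)
  also have "\<dots> = ev (cd g) \<cdot> ((idm (dual (cd g)) \<otimes> g) \<cdot> (idm (dual (cd g)) \<otimes> f))"
    by (simp add: comp_reassoc[OF F] I comp_reassoc[OF G])
  also have "\<dots> = ev (cd (g \<cdot> f)) \<cdot> (idm (dual (cd (g \<cdot> f))) \<otimes> (g \<cdot> f))"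
    by (simp add: interchange)
  finally show "ev (dm (g \<cdot> f)) \<cdot> ((dual_arr f \<cdot> dual_arr g) \<otimes> idm (dm (g \<cdot> f))) =
      ev (cd (g \<cdot> f)) \<cdot> (idm (dual (cd (g \<cdot> f))) \<otimes> (g \<cdot> f))"
    by simp
qed (use assms in auto)

lemma coev_dual_arr:
  assumes "arr f"
  shows "(f \<otimes> idm (dual (dm f))) \<cdot> coev (dm f) = (idm (cd f) \<otimes> dual_arr f) \<cdot> coev (cd f)"
proof -
  define a b where "a = dm f" and "b = cd f"
  have [simp]: "arr f" "a \<in> Ob" "b \<in> Ob" "dm f = a" "cd f = b"
    unfolding a_def b_def using assms by auto
  have I1: "idm b \<otimes> (ev b \<cdot> (idm (dual b) \<otimes> f)) = (idm b \<otimes> ev b) \<cdot> (idm b \<otimes> (idm (dual b) \<otimes> f))"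
    by (simp add: interchange)
  have I2: "(idm b \<otimes> (idm (dual b) \<otimes> f)) \<cdot> as b (dual b) a = as b (dual b) b \<cdot> (idm (b \<odot> dual b) \<otimes> f)"
    using assoc_nat[of "idm b" "idm (dual b)" f] by simp
  have I3: "(idm (b \<odot> dual b) \<otimes> f) \<cdot> (coev b \<otimes> idm a) = (coev b \<otimes> idm b) \<cdot> (idm U \<otimes> f)"
    by (simp add: interchange)
  have I4: "(idm U \<otimes> f) \<cdot> iv (lu a) = iv (lu b) \<cdot> f"
    by (rule iso_flip[symmetric]) (use lunit_nat[of f] in auto)
  have "snake b (dual b) a (ev b \<cdot> (idm (dual b) \<otimes> f)) (coev b) =
      snake b (dual b) b (ev b) (coev b) \<cdot> f"
    unfolding snake_def I1 by (simp add: comp_reassoc[OF I2] comp_reassoc[OF I3] I4)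
  then have "snake b (dual b) a (ev b \<cdot> (idm (dual b) \<otimes> f)) (coev b) = f"
    by simp
  moreover have "(idm b \<otimes> dual_arr f) \<cdot> coev b =
      (snake b (dual b) a (ev b \<cdot> (idm (dual b) \<otimes> f)) (coev b) \<otimes> idm (dual a)) \<cdot> coev a"
    unfolding dual_arr_def by (simp only: \<open>dm f = a\<close> \<open>cd f = b\<close>)
      (rule tensor_mate_coev[where ev="ev a"], auto)
  ultimately show ?thesis by simp
qed

lemma d_ev_dinatural:
  assumes "arr f"
  shows "dev (dm f) \<cdot> (idm (Do (dual (dm f))) \<otimes> D f) = dev (cd f) \<cdot> (D (dual_arr f) \<otimes> idm (Do (cd f)))"
proof -
  define a b where "a = dm f" and "b = cd f"
  have [simp]: "arr f" "a \<in> Ob" "b \<in> Ob" "dm f = a" "cd f = b"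
    unfolding a_def b_def using assms by auto
  have B1: "br (Do (dual a)) (Do a) \<cdot> (idm (Do (dual a)) \<otimes> D f) =
      (D f \<otimes> idm (Do (dual a))) \<cdot> br (Do (dual a)) (Do b)"
    using braid_nat[of "idm (Do (dual a))" "D f"] by simp
  have M1: "iv (mu a (dual a)) \<cdot> (D f \<otimes> idm (Do (dual a))) = D (f \<otimes> idm (dual a)) \<cdot> iv (mu b (dual a))"
    using mu_nat_inv[of f "idm (dual a)"] by simp
  have B2: "br (Do (dual b)) (Do b) \<cdot> (D (dual_arr f) \<otimes> idm (Do b)) =
      (idm (Do b) \<otimes> D (dual_arr f)) \<cdot> br (Do (dual a)) (Do b)"
    using braid_nat[of "D (dual_arr f)" "idm (Do b)"] by simp
  have M2: "iv (mu b (dual b)) \<cdot> (idm (Do b) \<otimes> D (dual_arr f)) =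
      D (idm b \<otimes> dual_arr f) \<cdot> iv (mu b (dual a))"
    using mu_nat_inv[of "idm b" "dual_arr f"] by simp
  have C: "D (coev b) \<cdot> D (idm b \<otimes> dual_arr f) = D (coev a) \<cdot> D (f \<otimes> idm (dual a))"
    using coev_dual_arr[of f] by (simp add: D_comp[symmetric])
  have "dev a \<cdot> (idm (Do (dual a)) \<otimes> D f) =
      ep \<cdot> (D (coev a) \<cdot> (D (f \<otimes> idm (dual a)) \<cdot> (iv (mu b (dual a)) \<cdot> br (Do (dual a)) (Do b))))"
    by (simp add: d_ev_eq d_ev'_def B1 comp_reassoc[OF B1] comp_reassoc[OF M1])
  also have "\<dots> = ep \<cdot> (D (coev b) \<cdot>
      (D (idm b \<otimes> dual_arr f) \<cdot> (iv (mu b (dual a)) \<cdot> br (Do (dual a)) (Do b))))"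
    by (simp add: comp_reassoc[OF C])
  also have "\<dots> = dev b \<cdot> (D (dual_arr f) \<otimes> idm (Do b))"
    by (simp add: d_ev_eq d_ev'_def B2 comp_reassoc[OF B2] comp_reassoc[OF M2])
  finally show ?thesis by simp
qed

lemma canon_natural:
  assumes "arr f"
  shows "dual_arr (D f) \<cdot> canon (dm f) = canon (cd f) \<cdot> D (dual_arr f)"
proof -
  define a b where "a = dm f" and "b = cd f"
  have [simp]: "arr f" "a \<in> Ob" "b \<in> Ob" "dm f = a" "cd f = b"
    unfolding a_def b_def using assms by auto
  have FE: "ev (Do b) \<cdot> (dual_arr (D f) \<otimes> idm (Do b)) = ev (Do a) \<cdot> (idm (dual (Do a)) \<otimes> D f)"
    using ev_dual_arr[of "D f"] by simp
  have I: "(idm (dual (Do a)) \<otimes> D f) \<cdot> (canon a \<otimes> idm (Do b)) =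
      (canon a \<otimes> idm (Do a)) \<cdot> (idm (Do (dual a)) \<otimes> D f)"
    by (simp add: interchange)
  have "ev (Do b) \<cdot> ((dual_arr (D f) \<cdot> canon a) \<otimes> idm (Do b)) =
      ev (Do b) \<cdot> ((dual_arr (D f) \<otimes> idm (Do b)) \<cdot> (canon a \<otimes> idm (Do b)))"
    by (simp add: interchange)
  also have "\<dots> = dev a \<cdot> (idm (Do (dual a)) \<otimes> D f)"
    by (simp add: comp_reassoc[OF FE] I comp_reassoc[OF ev_canon])
  also have "\<dots> = dev b \<cdot> (D (dual_arr f) \<otimes> idm (Do b))"
    using d_ev_dinatural[OF assms] by simp
  also have "\<dots> = ev (Do b) \<cdot> ((canon b \<otimes> idm (Do b)) \<cdot> (D (dual_arr f) \<otimes> idm (Do b)))"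
    by (simp add: comp_reassoc[OF ev_canon])
  also have "\<dots> = ev (Do b) \<cdot> ((canon b \<cdot> D (dual_arr f)) \<otimes> idm (Do b))"
    by (simp add: interchange)
  finally have E: "ev (Do b) \<cdot> ((dual_arr (D f) \<cdot> canon a) \<otimes> idm (Do b)) =
      ev (Do b) \<cdot> ((canon b \<cdot> D (dual_arr f)) \<otimes> idm (Do b))" .
  show ?thesis
    unfolding a_def[symmetric] b_def[symmetric]
    by (rule ev_cancel_dual[of "Do b", OF _ _ _ _ _ _ E]) simp_all
qed

lemma ev_inv_eta:
  assumes "a \<in> Ob"
  shows "ev a \<cdot> (iv (eta (dual a)) \<otimes> iv (eta a)) = ep \<cdot> (D (d_coev' a) \<cdot> iv (mu (Do (dual a)) (Do a)))"
proof -
  note [simp] = assms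
  have E1: "ev a = iv (eta U) \<cdot> (D (D (ev a)) \<cdot> eta (dual a \<odot> a))"
    by (rule iso_solve_left) (use eta_nat[of "ev a"] in auto)
  have E2: "iv (eta U) = ep \<cdot> D (iv ep)"
    unfolding eta_unit by (simp add: inv_of_comp inv_D)
  have E3: "eta (dual a \<odot> a) =
      D (mu (dual a) a) \<cdot> (iv (mu (Do (dual a)) (Do a)) \<cdot> (eta (dual a) \<otimes> eta a))"
    using eta_tensor[of "dual a" a] by simp
  have E4: "(eta (dual a) \<otimes> eta a) \<cdot> (iv (eta (dual a)) \<otimes> iv (eta a)) =
      idm (Do (Do (dual a)) \<odot> Do (Do a))"
    by (simp add: interchange)
  have "ev a \<cdot> (iv (eta (dual a)) \<otimes> iv (eta a)) =
      (iv (eta U) \<cdot> (D (D (ev a)) \<cdot> eta (dual a \<odot> a))) \<cdot> (iv (eta (dual a)) \<otimes> iv (eta a))"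
    by (simp only: E1[symmetric])
  also have "\<dots> = ep \<cdot> (D (iv ep) \<cdot> (D (D (ev a)) \<cdot> (D (mu (dual a) a) \<cdot> iv (mu (Do (dual a)) (Do a)))))"
    by (simp add: E2 E3 E4 comp_reassoc[OF E4])
  also have "\<dots> = ep \<cdot> (D (d_coev' a) \<cdot> iv (mu (Do (dual a)) (Do a)))"
    unfolding d_coev'_def by (simp add: D_comp)
  finally show ?thesis .
qed

lemma canon_tensor_d_coev':
  assumes "a \<in> Ob"
  shows "(canon a \<otimes> idm (Do a)) \<cdot> d_coev' a = br (Do a) (dual (Do a)) \<cdot> coev (Do a)"
proof -
  note [simp] = assms
  have "d_coev' a = br (Do a) (Do (dual a)) \<cdot> dcoev a"
    by (simp add: d_coev_eq)
  moreover have B: "(canon a \<otimes> idm (Do a)) \<cdot> br (Do a) (Do (dual a)) =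
      br (Do a) (dual (Do a)) \<cdot> (idm (Do a) \<otimes> canon a)"
    using braid_nat[of "idm (Do a)" "canon a"] by simp
  ultimately show ?thesis
    by (simp add: comp_reassoc[OF B] canon_coev)
qed

lemma ev_inv_eta_D_canon:
  assumes "a \<in> Ob"
  shows "ev a \<cdot> ((iv (eta (dual a)) \<cdot> D (canon a)) \<otimes> idm a) =
    dev (Do a) \<cdot> (idm (Do (dual (Do a))) \<otimes> eta a)"
proof -
  note [simp] = assms
  have T: "(iv (eta (dual a)) \<cdot> D (canon a)) \<otimes> idm a =
      (iv (eta (dual a)) \<otimes> iv (eta a)) \<cdot> (D (canon a) \<otimes> eta a)"
    by (simp add: interchange)
  have M: "iv (mu (Do (dual a)) (Do a)) \<cdot> (D (canon a) \<otimes> idm (Do (Do a))) =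
      D (canon a \<otimes> idm (Do a)) \<cdot> iv (mu (dual (Do a)) (Do a))"
    using mu_nat_inv[of "canon a" "idm (Do a)"] by simp
  have I: "D (canon a) \<otimes> eta a = (D (canon a) \<otimes> idm (Do (Do a))) \<cdot> (idm (Do (dual (Do a))) \<otimes> eta a)"
    by (simp add: interchange)
  have B: "D (br (Do a) (dual (Do a))) \<cdot> iv (mu (dual (Do a)) (Do a)) =
      iv (mu (Do a) (dual (Do a))) \<cdot> br (Do (dual (Do a))) (Do (Do a))"
    by (rule iso_flip[symmetric]) (use mu_braid[of "Do a" "dual (Do a)"] in auto)
  have "ev a \<cdot> ((iv (eta (dual a)) \<cdot> D (canon a)) \<otimes> idm a) =
      ep \<cdot> (D (d_coev' a) \<cdot> (D (canon a \<otimes> idm (Do a)) \<cdot> (iv (mu (dual (Do a)) (Do a)) \<cdot>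
        (idm (Do (dual (Do a))) \<otimes> eta a))))"
    unfolding T I by (simp add: comp_reassoc[OF ev_inv_eta] comp_reassoc[OF M])
  also have "\<dots> = ep \<cdot> (D ((canon a \<otimes> idm (Do a)) \<cdot> d_coev' a) \<cdot> (iv (mu (dual (Do a)) (Do a)) \<cdot>
      (idm (Do (dual (Do a))) \<otimes> eta a)))"
    by (simp add: D_comp)
  also have "\<dots> = dev (Do a) \<cdot> (idm (Do (dual (Do a))) \<otimes> eta a)"
    unfolding canon_tensor_d_coev'[OF assms] d_ev_def by (simp add: D_comp comp_reassoc[OF B])
  finally show ?thesis .
qed

lemma canon_eta:
  assumes "a \<in> Ob"
  shows "dual_arr (eta a) \<cdot> canon (Do a) = iv (eta (dual a)) \<cdot> D (canon a)"
proof -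
  note [simp] = assms
  have FE: "ev a \<cdot> (dual_arr (eta a) \<otimes> idm a) = ev (Do (Do a)) \<cdot> (idm (dual (Do (Do a))) \<otimes> eta a)"
    using ev_dual_arr[of "eta a"] by simp
  have I: "(idm (dual (Do (Do a))) \<otimes> eta a) \<cdot> (canon (Do a) \<otimes> idm a) =
      (canon (Do a) \<otimes> idm (Do (Do a))) \<cdot> (idm (Do (dual (Do a))) \<otimes> eta a)"
    by (simp add: interchange)
  have "ev a \<cdot> ((dual_arr (eta a) \<cdot> canon (Do a)) \<otimes> idm a) =
      ev a \<cdot> ((dual_arr (eta a) \<otimes> idm a) \<cdot> (canon (Do a) \<otimes> idm a))"
    by (simp add: interchange)
  also have "\<dots> = dev (Do a) \<cdot> (idm (Do (dual (Do a))) \<otimes> eta a)"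
    by (simp add: comp_reassoc[OF FE] I comp_reassoc[OF ev_canon])
  also have "\<dots> = ev a \<cdot> ((iv (eta (dual a)) \<cdot> D (canon a)) \<otimes> idm a)"
    by (simp add: ev_inv_eta_D_canon)
  finally have E: "ev a \<cdot> ((dual_arr (eta a) \<cdot> canon (Do a)) \<otimes> idm a) =
      ev a \<cdot> ((iv (eta (dual a)) \<cdot> D (canon a)) \<otimes> idm a)" .
  show ?thesis
    by (rule ev_cancel_dual[of a, OF _ _ _ _ _ _ E]) simp_all
qed

lemma dual_anti_involutive_functor:
  "anti_involutive_functor C d0 d1 eta (mc_op C) d0 d1 (\<lambda>a. iv (eta a))
     dual (dual_mor C dual ev) (canon_iso C d0 d1 dmu deps dual ev coev)"
  unfolding anti_involutive_functor_def
proof (intro conjI ballI)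
  show "mc_functor C (mc_op C) dual (dual_mor C dual ev)"
    unfolding mc_functor_def by (auto simp: dual_mor_eq dual_arr_id dual_arr_comp mc_hom_def)
next
  fix a
  assume "a \<in> mc_obj C"
  then show "phi a \<in> mc_hom (mc_op C) (dual (Do a)) (Do (dual a))" "mc_iso (mc_op C) (phi a)"
    by (auto simp: canon_iso_eq iso_canon mc_hom_def)
next
  fix f
  assume "f \<in> mc_arr C"
  then show "mc_cmp (mc_op C) (phi (dm f)) (dual_mor C dual ev (D f)) =
      mc_cmp (mc_op C) (D (dual_mor C dual ev f)) (phi (cd f))"
    by (simp add: canon_iso_eq dual_mor_eq canon_natural)
next
  fix a
  assume "a \<in> mc_obj C"
  then show "mc_cmp (mc_op C) (phi (Do a)) (dual_mor C dual ev (eta a)) =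
      mc_cmp (mc_op C) (D (phi a)) (iv (eta (dual a)))"
    by (simp add: canon_iso_eq dual_mor_eq canon_eta)
qed

end

theorem mainTheorem11:
  fixes C :: "('o, 'm, 'x) mcat_scheme"
    and d0 :: "'o \<Rightarrow> 'o" and d1 :: "'m \<Rightarrow> 'm"
    and dmu :: "'o \<Rightarrow> 'o \<Rightarrow> 'm" and deps :: "'m" and eta :: "'o \<Rightarrow> 'm"
    and dual :: "'o \<Rightarrow> 'o" and ev coev :: "'o \<Rightarrow> 'm"
  assumes "anti_involutive_category C d0 d1 dmu deps eta"
    and "dual_choice C dual ev coev"
  shows "anti_involutive_functor
           C d0 d1 eta
           (mc_op C) d0 d1 (\<lambda>a. mc_inv C (eta a))
           dual (dual_mor C dual ev) (canon_iso C d0 d1 dmu deps dual ev coev)"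
proof -
  have "symmetric_monoidal_category C"
    using assms(1) unfolding anti_involutive_category_def by (rule conjunct1)
  then interpret anti_involutive_duals C d0 d1 dmu deps eta dual ev coev
    using assms by unfold_locales
  show ?thesis
    by (rule dual_anti_involutive_functor)
qed

end
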